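(* Suppose there are constants $C_1,C_2,C_3,C_4>0$ and $t_1,t_2,t_3,t_4\ge0$ such that, for all sufficiently small $h>0$, $$C_1h^{t_1}\exp\big[-C_2(1/h)^{t_2}(\log(1/h))^{t_3}\big]\le\phi(\mathbf{x},h)\le C_3h^{t_4}\exp\big[-C_4(1/h)^{t_2}(\log(1/h))^{t_3}\big],$$ and that either $t_2>0$, or $t_3>1$ is an integer and $C_2=C_4$. Let $m(h)=C_2(1/h)^{t_2}(\log(1/h))^{t_3}$ for $0<h<1$, with inverse function $m^{-1}$. Let the kernel $K$ satisfy $l\le K(u)\le L$ for $0\le u\le1$ with constants $0<l\le L$, and $K(u)=0$ for $u>1$. Assume that for some $\beta>0$, $b_F>0$ one has $\|F(\mathbf{z})-F(\mathbf{x})\|\le b_F\,d(\mathbf{x},\mathbf{z})^\beta$ for all $\mathbf{z}$ in a neighborhood of $\mathbf{x}$; that for some $\nu>2$ the quantity $\mathbb{E}\big[\|G(\mathbf{Y})-\mathbb{E}[G(\mathbf{Y})\mid\mathbf{X}=\mathbf{z}]\|^\nu\mid\mathbf{X}=\mathbf{z}\big]$ is uniformly bounded for $\mathbf{z}$ in a neighborhood of $\mathbf{x}$; and that for every bandwidth sequence $\{h_n\}$ with $h_n\to0$ and $n\phi(\mathbf{x},h_n)\to\infty$ the estimate $\widehat{\Theta}_n(\mathbf{x})$ constructed with $h_n$ satisfies $\widehat{\Theta}_n(\mathbf{x})-\Theta(\mathbf{x})=B_n(\mathbf{x})+V_n(\mathbf{x})+R_n(\mathbf{x})$ with $R_n(\mathbf{x})=o_{\mathbb{P}}(\delta_n)$,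 $\delta_n=\max\{h_n^\beta,[n\phi(\mathbf{x},h_n)]^{-1/2}\}$. Then there is a sequence of bandwidths $\{h_n\}$ with $h_n\to0$ and $n\phi(\mathbf{x},h_n)\to\infty$ such that $$\big\|\widehat{\Theta}_n(\mathbf{x})-\Theta(\mathbf{x})\big\|=O_{\mathbb{P}}\big((m^{-1}(\log n))^\beta\big)\quad\text{as }n\to\infty.$$ Further, if $\mathbb{E}[\|R_n(\mathbf{x})\|^2]=o(\delta_n^2)$ as $n\to\infty$, then for this same sequence of bandwidths $$\mathbb{E}\big\|\widehat{\Theta}_n(\mathbf{x})-\Theta(\mathbf{x})\big\|^2=O\big((m^{-1}(\log n))^{2\beta}\big)\quad\text{as }n\to\infty.$$
   Context: $(\mathcal{C},d)$ is a complete separable metric space, $\mathcal{R}$ is a measurable space, $(\mathbf{X},\mathbf{Y})$ is a random element of $\mathcal{C}\times\mathcal{R}$, and $(\mathbf{X}_i,\mathbf{Y}_i)$, $i\ge1$, are i.i.d. copies. A regular conditional distribution of $\mathbf{Y}$ given $\mathbf{X}=\mathbf{z}$ is fixed and $\mathbb{E}[\,\cdot\mid\mathbf{X}=\mathbf{z}]$ is taken with respect to it; Banach-space-valued expectations are in the Bochner sense. $\mathbf{x}\in\mathcal{C}$ is fixed and $\phi(\mathbf{x},h)=\mathbb{P}[d(\mathbf{x},\mathbf{X})\le h]$. $K:[0,\infty)\to[0,\infty)$ is a measurable kernel; bandwidths are positive and deterministic. $\mathcal{B}$ is a separable Banach space of type 2 with a Schauder basis (type 2: there is $c>0$ with $\mathbb{E}\|\sum_{i\le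 n}\mathbf{Z}_i\|^2\le c\sum_{i\le n}\mathbb{E}\|\mathbf{Z}_i\|^2$ for all $n$ and all independent zero-mean $\mathbf{Z}_i$ with finite second moments), $\mathcal{G}$ is a separable Banach space, $F:\mathcal{C}\to\mathcal{G}$ and $G:\mathcal{R}\to\mathcal{G}$ are measurable, $\mathbb{L}_{\mathbf{x}}:\mathcal{G}\to\mathcal{B}$ is continuous linear. The parameter $\Theta(\mathbf{x})\in\mathcal{B}$ is a functional of the conditional distribution of $\mathbf{Y}$ given $\mathbf{X}=\mathbf{x}$, and its kernel estimate $\widehat{\Theta}_n(\mathbf{x})$ is the same functional of the weighted empirical measure putting mass $K(h_n^{-1}d(\mathbf{x},\mathbf{X}_i))/\sum_jK(h_n^{-1}d(\mathbf{x},\mathbf{X}_j))$ at $\mathbf{Y}_i$. Here $$B_n(\mathbf{x})=\mathbb{L}_{\mathbf{x}}\left(\frac{\sum_{i=1}^{n}F(\mathbf{X}_i)K(h_n^{-1}d(\mathbf{x},\mathbf{X}_i))}{\sum_{i=1}^{n}K(h_n^{-1}d(\mathbf{x},\mathbf{X}_i))}-F(\mathbf{x})\right),$$ $$V_n(\mathbf{x})=\mathbb{L}_{\mathbf{x}}\left(\frac{\sum_{i=1}^{n}\big[G(\mathbf{Y}_i)-\mathbb{E}[G(\mathbf{Y}_i)\mid\mathbf{X}_i]\big]K(h_n^{-1}d(\mathbf{x},\mathbf{X}_i))}{\sum_{i=1}^{n}K(h_n^{-1}d(\mathbf{x},\mathbf{X}_i))}\right),$$ and quotients with zero denominator are read as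 $0$. The function $m$ is strictly decreasing on $(0,1)$ with $m(h)\to\infty$ as $h\to0^+$, so $m^{-1}(\log n)$ is defined for all large $n$. *)

theory Defs
  imports "HOL-Probability.Probability" "HOL-Library.Landau_Symbols"
begin

text \<open>
  A definition cannot quantify over the type of the sample space. The sample type
  \<^typ>\<open>nat \<Rightarrow> 'b\<close> loses nothing: every finite independent family of Borel random elements
  of \<^typ>\<open>'b\<close> has the same joint law as a family of coordinate maps on a product space of
  this type. The probability measure and its sigma-algebra are arbitrary.
\<close>

definition type_two :: "'b::{banach, second_countable_topology} itself \<Rightarrow> bool" where
  "type_two _ \<longleftrightarrow>
    (\<exists>c>0. \<forall>(P :: (nat \<Rightarrow> 'b) measure) (Z :: nat \<Rightarrow> (nat \<Rightarrow> 'b) \<Rightarrow> 'b) n.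
      prob_space P \<and> prob_space.indep_vars P (\<lambda>_. borel) Z {1..n} \<and>
      (\<forall>i\<in>{1..n}. integrable P (Z i) \<and> integral\<^sup>L P (Z i) = 0 \<and>
                   integrable P (\<lambda>\<omega>. (norm (Z i \<omega>))\<^sup>2)) \<longrightarrow>
      (\<integral>\<omega>. (norm (\<Sum>i=1..n. Z i \<omega>))\<^sup>2 \<partial>P) \<le> c * (\<Sum>i=1..n. \<integral>\<omega>. (norm (Z i \<omega>))\<^sup>2 \<partial>P))"

text \<open>
  The basis is indexed by all naturals or, so that finite-dimensional spaces are included,
  by an initial segment.
\<close>

definition schauder_basis :: "nat set \<Rightarrow> (nat \<Rightarrow> 'b::real_normed_vector) \<Rightarrow> bool" where
  "schauder_basis I e \<longleftrightarrow>
    (I = UNIV \<or> (\<exists>k. I = {..<k})) \<and>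
    (\<forall>v. \<exists>!a :: nat \<Rightarrow> real. (\<forall>i. i \<notin> I \<longrightarrow> a i = 0) \<and> (\<lambda>i. a i *\<^sub>R e i) sums v)"

definition regular_cond_distr ::
  "'w measure \<Rightarrow> 'c measure \<Rightarrow> ('w \<Rightarrow> 'c) \<Rightarrow> 'r measure \<Rightarrow> ('w \<Rightarrow> 'r) \<Rightarrow> ('c \<Rightarrow> 'r measure) \<Rightarrow> bool"
where
  "regular_cond_distr M S X N Y \<kappa> \<longleftrightarrow>
    \<kappa> \<in> S \<rightarrow>\<^sub>M prob_algebra N \<and>
    (\<forall>A\<in>sets S. \<forall>B\<in>sets N.
      emeasure M {\<omega>\<in>space M. X \<omega> \<in> A \<and> Y \<omega> \<in> B}
        = (\<integral>\<^sup>+z\<in>A. emeasure (\<kappa> z) B \<partial>distr M S X))"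

definition bigO_in_prob ::
  "'w measure \<Rightarrow> (nat \<Rightarrow> 'w \<Rightarrow> 'b::real_normed_vector) \<Rightarrow> (nat \<Rightarrow> real) \<Rightarrow> bool" where
  "bigO_in_prob M Z a \<longleftrightarrow>
    (\<forall>\<epsilon>>0. \<exists>C>0. \<forall>\<^sub>F n in sequentially.
      measure M {\<omega>\<in>space M. norm (Z n \<omega>) > C * a n} \<le> \<epsilon>)"

definition smallo_in_prob ::
  "'w measure \<Rightarrow> (nat \<Rightarrow> 'w \<Rightarrow> 'b::real_normed_vector) \<Rightarrow> (nat \<Rightarrow> real) \<Rightarrow> bool" where
  "smallo_in_prob M Z a \<longleftrightarrow>
    (\<forall>\<epsilon>>0. (\<lambda>n. measure M {\<omega>\<in>space M. norm (Z n \<omega>) > \<epsilon> * a n}) \<longlonglongrightarrow> 0)"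

text \<open>
  The Bochner integral of a non-integrable function is 0, so that finiteness of the second
  moments has to be stated separately.
\<close>

definition mean_square_bigO ::
  "'w measure \<Rightarrow> (nat \<Rightarrow> 'w \<Rightarrow> 'b::real_normed_vector) \<Rightarrow> (nat \<Rightarrow> real) \<Rightarrow> bool" where
  "mean_square_bigO M Z a \<longleftrightarrow>
    (\<forall>\<^sub>F n in sequentially. integrable M (\<lambda>\<omega>. (norm (Z n \<omega>))\<^sup>2)) \<and>
    (\<lambda>n. \<integral>\<omega>. (norm (Z n \<omega>))\<^sup>2 \<partial>M) \<in> O(a)"

definition mean_square_smallo ::
  "'w measure \<Rightarrow> (nat \<Rightarrow> 'w \<Rightarrow> 'b::real_normed_vector) \<Rightarrow> (nat \<Rightarrow> real) \<Rightarrow> bool" where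
  "mean_square_smallo M Z a \<longleftrightarrow>
    (\<forall>\<^sub>F n in sequentially. integrable M (\<lambda>\<omega>. (norm (Z n \<omega>))\<^sup>2)) \<and>
    (\<lambda>n. \<integral>\<omega>. (norm (Z n \<omega>))\<^sup>2 \<partial>M) \<in> o(a)"

definition small_ball_prob :: "'w measure \<Rightarrow> ('w \<Rightarrow> 'c::metric_space) \<Rightarrow> 'c \<Rightarrow> real \<Rightarrow> real" where
  "small_ball_prob M X x h = measure M {\<omega>\<in>space M. dist x (X \<omega>) \<le> h}"

definition small_ball_exponent :: "real \<Rightarrow> real \<Rightarrow> real \<Rightarrow> real \<Rightarrow> real" where
  "small_ball_exponent C s t h = C * (1 / h) powr s * (ln (1 / h)) powr t"

text \<open>
  Below, \<open>h\<close> is the bandwidth used with sample size \<open>n\<close>, and \<open>\<kappa>\<close> is the regular conditional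
  distribution. Quotients with denominator 0 are 0, both for real division and for \<open>/\<^sub>R\<close>; if
  all weights vanish, the weighted empirical measure is therefore the null measure.
\<close>

definition kernel_weight ::
  "(real \<Rightarrow> real) \<Rightarrow> 'c::metric_space \<Rightarrow> (nat \<Rightarrow> 'w \<Rightarrow> 'c) \<Rightarrow> real \<Rightarrow> 'w \<Rightarrow> nat \<Rightarrow> real" where
  "kernel_weight K x Xs h \<omega> i = K (dist x (Xs i \<omega>) / h)"

definition weighted_empirical ::
  "'r measure \<Rightarrow> (real \<Rightarrow> real) \<Rightarrow> 'c::metric_space \<Rightarrow> (nat \<Rightarrow> 'w \<Rightarrow> 'c) \<Rightarrow> (nat \<Rightarrow> 'w \<Rightarrow> 'r) \<Rightarrow>
    real \<Rightarrow> nat \<Rightarrow> 'w \<Rightarrow> 'r measure" where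
  "weighted_empirical N K x Xs Ys h n \<omega> =
    distr
      (point_measure {1..n}
        (\<lambda>i. ennreal (kernel_weight K x Xs h \<omega> i / (\<Sum>j=1..n. kernel_weight K x Xs h \<omega> j))))
      N (\<lambda>i. Ys i \<omega>)"

definition bias_term ::
  "('g::real_normed_vector \<Rightarrow> 'b::real_normed_vector) \<Rightarrow> ('c::metric_space \<Rightarrow> 'g) \<Rightarrow>
    (real \<Rightarrow> real) \<Rightarrow> 'c \<Rightarrow> (nat \<Rightarrow> 'w \<Rightarrow> 'c) \<Rightarrow> real \<Rightarrow> nat \<Rightarrow> 'w \<Rightarrow> 'b" where
  "bias_term L F K x Xs h n \<omega> =
    L ((\<Sum>i=1..n. kernel_weight K x Xs h \<omega> i *\<^sub>R F (Xs i \<omega>))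
         /\<^sub>R (\<Sum>i=1..n. kernel_weight K x Xs h \<omega> i) - F x)"

definition variance_term ::
  "('g::{banach, second_countable_topology} \<Rightarrow> 'b::real_normed_vector) \<Rightarrow> ('r \<Rightarrow> 'g) \<Rightarrow>
    ('c::metric_space \<Rightarrow> 'r measure) \<Rightarrow> (real \<Rightarrow> real) \<Rightarrow> 'c \<Rightarrow> (nat \<Rightarrow> 'w \<Rightarrow> 'c) \<Rightarrow>
    (nat \<Rightarrow> 'w \<Rightarrow> 'r) \<Rightarrow> real \<Rightarrow> nat \<Rightarrow> 'w \<Rightarrow> 'b" where
  "variance_term L G \<kappa> K x Xs Ys h n \<omega> =
    L ((\<Sum>i=1..n. kernel_weight K x Xs h \<omega> i *\<^sub>R (G (Ys i \<omega>) - (\<integral>y. G y \<partial>\<kappa> (Xs i \<omega>))))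
         /\<^sub>R (\<Sum>i=1..n. kernel_weight K x Xs h \<omega> i))"

text \<open>\<open>T\<close> is the functional defining the parameter, and its value at \<open>\<kappa> x\<close> is the parameter.\<close>

definition estimation_error ::
  "('r measure \<Rightarrow> 'b::real_normed_vector) \<Rightarrow> 'r measure \<Rightarrow> ('c::metric_space \<Rightarrow> 'r measure) \<Rightarrow>
    (real \<Rightarrow> real) \<Rightarrow> 'c \<Rightarrow> (nat \<Rightarrow> 'w \<Rightarrow> 'c) \<Rightarrow> (nat \<Rightarrow> 'w \<Rightarrow> 'r) \<Rightarrow> real \<Rightarrow> nat \<Rightarrow> 'w \<Rightarrow> 'b" where
  "estimation_error T N \<kappa> K x Xs Ys h n \<omega> =
    T (weighted_empirical N K x Xs Ys h n \<omega>) - T (\<kappa> x)"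

definition remainder_term ::
  "('r measure \<Rightarrow> 'b::real_normed_vector) \<Rightarrow> ('g::{banach, second_countable_topology} \<Rightarrow> 'b) \<Rightarrow>
    ('c::metric_space \<Rightarrow> 'g) \<Rightarrow> ('r \<Rightarrow> 'g) \<Rightarrow> 'r measure \<Rightarrow> ('c \<Rightarrow> 'r measure) \<Rightarrow>
    (real \<Rightarrow> real) \<Rightarrow> 'c \<Rightarrow> (nat \<Rightarrow> 'w \<Rightarrow> 'c) \<Rightarrow> (nat \<Rightarrow> 'w \<Rightarrow> 'r) \<Rightarrow> real \<Rightarrow> nat \<Rightarrow> 'w \<Rightarrow> 'b" where
  "remainder_term T L F G N \<kappa> K x Xs Ys h n \<omega> =
    estimation_error T N \<kappa> K x Xs Ys h n \<omega>
      - bias_term L F K x Xs h n \<omega> - variance_term L G \<kappa> K x Xs Ys h n \<omega>"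

definition admissible_bandwidth ::
  "'w measure \<Rightarrow> ('w \<Rightarrow> 'c::metric_space) \<Rightarrow> 'c \<Rightarrow> (nat \<Rightarrow> real) \<Rightarrow> bool" where
  "admissible_bandwidth M X x h \<longleftrightarrow>
    (\<forall>n. h n > 0) \<and> h \<longlonglongrightarrow> 0 \<and>
    filterlim (\<lambda>n. real n * small_ball_prob M X x (h n)) at_top sequentially"

definition error_rate ::
  "'w measure \<Rightarrow> ('w \<Rightarrow> 'c::metric_space) \<Rightarrow> 'c \<Rightarrow> real \<Rightarrow> (nat \<Rightarrow> real) \<Rightarrow> nat \<Rightarrow> real" where
  "error_rate M X x \<beta> h n =
    max (h n powr \<beta>) ((real n * small_ball_prob M X x (h n)) powr (- 1 / 2))"

end

theory Submission
  imports Defs "HOL-Real_Asymp.Real_Asymp"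
begin

text \<open>
  Let \<open>N\<close> be the number of sample points in the ball of radius \<open>h\<close> and \<open>p\<close> the probability of that
  ball. The numerator of the variance term is a sum of independent centred vectors, so the type 2
  inequality applies to it unconditionally and settles the event \<open>N \<ge> n p / 2\<close>. On
  \<open>0 < N < n p / 2\<close> the weighted mean is bounded by convexity; after factoring out one sample point,
  the noise of that point is independent of the count of the remaining ones, so this part
  contributes at most a multiple of \<open>P (N < n p / 2)\<close>, which a Chernoff bound makes \<open>O (1 / (n p))\<close>.
  Hence bias and variance together have second moment \<open>O (h powr (2 * \<beta>) + 1 / (n p))\<close>.

  With \<open>r = m_inv (ln n)\<close> and \<open>h = a * r\<close>, the constant \<open>a > 1\<close> is chosen such that \<open>m (a * r)\<close> falls
  below \<open>m r = ln n\<close> by at least \<open>(t1 + 2 * \<beta> + 1) * ln (1 / r)\<close>. The lower small ball bound then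
  gives \<open>n p \<ge> C1 * r powr (- 2 * \<beta> - 1)\<close>, and every term is of the order of \<open>r powr \<beta>\<close>.
\<close>

section \<open>Integration against regular conditional distributions\<close>

text \<open>Numerator and denominator of the variance term share the same random weights, so the
  quotient is not a sum of independent terms, while \<open>type_two\<close> speaks of unconditional
  independent sums only. Replacing the denominator by the constant \<open>k_lo * n * p / 2\<close>
  frees the numerator, at the price of the event where too few points fall into the ball. There the
  noise is not bounded, only square integrable, so the probability of that event can be split off
  only once independence is restored; this is why the count is taken over the remaining points.

  With \<open>h = r\<close> itself the lower small ball bound would give only
  \<open>n * p \<ge> C1 * r powr t1\<close>, because \<open>exp (- m r) = 1 / n\<close>, and this
  does not yield admissibility. The factor \<open>a\<close> costs a constant in the bias, but lowers
  \<open>m\<close> by a prescribed multiple of \<open>ln (1 / r)\<close>. If \<open>t2 = 0\<close>,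
  a constant factor in the bandwidth shifts the logarithm by a constant, which lowers
  \<open>m\<close> by the order of \<open>ln (1 / r) powr (t3 - 1)\<close>. That reaches the order
  of \<open>ln (1 / r)\<close> once \<open>t3 \<ge> 2\<close>, as an integer \<open>t3 > 1\<close>
  provides.\<close>

lemma
  fixes f :: "_ \<Rightarrow> 'b::{banach, second_countable_topology}"
  assumes \<kappa>[measurable]: "\<kappa> \<in> M \<rightarrow>\<^sub>M subprob_algebra B"
    and f: "integrable (M \<bind> \<kappa>) f" and M: "space M \<noteq> {}"
  shows AE_integrable_kernel: "AE x in M. integrable (\<kappa> x) f"
    and integrable_integral_kernel: "integrable M (\<lambda>x. \<integral>y. f y \<partial>\<kappa> x)"
proof -
  have sets_eq: "sets (M \<bind> \<kappa>) = sets B"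
    using M by (intro sets_bind) (auto simp: subprob_measurableD[OF \<kappa>])
  have fm[measurable]: "f \<in> borel_measurable B"
    using borel_measurable_integrable[OF f] by (simp cong: measurable_cong_sets add: sets_eq)
  \<comment> \<open>Tonelli applied to the norm: this finite iterated integral yields both
    claims.\<close>
  have fin: "(\<integral>\<^sup>+x. \<integral>\<^sup>+y. norm (f y) \<partial>\<kappa> x \<partial>M) < \<infinity>"
    using f unfolding integrable_iff_bounded by (subst (asm) nn_integral_bind[where B=B]) auto
  have meas: "(\<lambda>x. \<integral>\<^sup>+y. norm (f y) \<partial>\<kappa> x) \<in> borel_measurable M" by measurable
  show AE: "AE x in M. integrable (\<kappa> x) f"
    using nn_integral_PInf_AE[OF meas] fin AE_space
    by (auto simp: integrable_iff_bounded less_top measurable_cong_sets[OF sets_kernel[OF \<kappa>] refl])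
  have "(\<integral>\<^sup>+x. norm (\<integral>y. f y \<partial>\<kappa> x) \<partial>M) \<le> (\<integral>\<^sup>+x. \<integral>\<^sup>+y. norm (f y) \<partial>\<kappa> x \<partial>M)"
    using AE by (auto intro!: nn_integral_mono_AE integral_norm_bound_ennreal)
  also note fin
  finally show "integrable M (\<lambda>x. \<integral>y. f y \<partial>\<kappa> x)"
    by (intro integrableI_bounded) measurable
qed

text \<open>Induction on integrable functions: for indicators this is the formula for the measure of
  a composed kernel, and it passes to sums and dominated limits. The inner integrals exist only
  almost everywhere; the value 0 taken elsewhere affects a null set.\<close>

lemma integral_kernel:
  fixes f :: "_ \<Rightarrow> 'b::{banach, second_countable_topology}"
  assumes \<kappa>[measurable]: "\<kappa> \<in> M \<rightarrow>\<^sub>M subprob_algebra B" and M: "finite_measure M" "space M \<noteq> {}"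
    and f: "integrable (M \<bind> \<kappa>) f"
  shows "(\<integral>x. \<integral>y. f y \<partial>\<kappa> x \<partial>M) = (\<integral>y. f y \<partial>(M \<bind> \<kappa>))"
proof -
  interpret finite_measure M by fact
  note AE_int = AE_integrable_kernel[OF \<kappa> _ M(2)]
    and int_int = integrable_integral_kernel[OF \<kappa> _ M(2)]
  have sets_eq[measurable_cong]: "sets (M \<bind> \<kappa>) = sets B"
    using M by (intro sets_bind) (auto simp: subprob_measurableD[OF \<kappa>])
  show ?thesis
    using f
  proof induct
    case (base A c)
    then have A[measurable]: "A \<in> sets B" by (simp add: sets_eq)
    have ind: "integrable (M \<bind> \<kappa>) (indicator A :: _ \<Rightarrow> real)"
      using base by (intro integrable_real_indicator)
    have subp: "subprob_space (\<kappa> x)" if "x \<in> space M" for x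
      using measurable_space[OF \<kappa> that] by (simp add: space_subprob_algebra)
    have le1: "measure (\<kappa> x) A \<le> 1" if "x \<in> space M" for x
      using subprob_space.subprob_measure_le_1[OF subp[OF that]] .
    have i: "integrable M (\<lambda>x. measure (\<kappa> x) A)"
      by (rule integrable_const_bound[where B=1]) (use le1 in auto)
    have e: "(\<integral>y. indicator A y *\<^sub>R c \<partial>\<kappa> x) = measure (\<kappa> x) A *\<^sub>R c" if "x \<in> space M" for x
    proof -
      interpret subprob_space "\<kappa> x" using subp[OF that] .
      have "A \<in> sets (\<kappa> x)" using A sets_kernel[OF \<kappa> that] by simp
      then have "integrable (\<kappa> x) (indicator A :: _ \<Rightarrow> real)"
        by (intro integrable_real_indicator) (auto simp: less_top[symmetric])
      moreover have "A \<inter> space (\<kappa> x) = A"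
        using \<open>A \<in> sets (\<kappa> x)\<close> sets.sets_into_space by auto
      ultimately show ?thesis by simp
    qed
    have "(\<integral>x. \<integral>y. indicator A y *\<^sub>R c \<partial>\<kappa> x \<partial>M) = (\<integral>x. measure (\<kappa> x) A *\<^sub>R c \<partial>M)"
      by (intro Bochner_Integration.integral_cong refl e)
    also have "\<dots> = (\<integral>x. measure (\<kappa> x) A \<partial>M) *\<^sub>R c" using i by simp
    also have "(\<integral>x. measure (\<kappa> x) A \<partial>M) = measure (M \<bind> \<kappa>) A"
    proof -
      have "emeasure (M \<bind> \<kappa>) A = (\<integral>\<^sup>+x. emeasure (\<kappa> x) A \<partial>M)"
        using M(2) by (intro emeasure_bind[where N=B]) auto
      also have "\<dots> = (\<integral>\<^sup>+x. ennreal (measure (\<kappa> x) A) \<partial>M)"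
        by (intro nn_integral_cong)
          (simp add: finite_measure.emeasure_eq_measure[OF subprob_space.axioms(1)[OF subp]])
      also have "\<dots> = ennreal (\<integral>x. measure (\<kappa> x) A \<partial>M)"
        by (intro nn_integral_eq_integral i) auto
      finally show ?thesis by (simp add: measure_def integral_nonneg)
    qed
    also have "measure (M \<bind> \<kappa>) A *\<^sub>R c = (\<integral>y. indicator A y *\<^sub>R c \<partial>(M \<bind> \<kappa>))"
      using base by simp
    finally show ?case .
  next
    case (add f g)
    then have [measurable]: "f \<in> borel_measurable B" "g \<in> borel_measurable B" by (auto simp: sets_eq cong: measurable_cong_sets)
    have "(\<integral>x. \<integral>y. f y + g y \<partial>\<kappa> x \<partial>M) = (\<integral>x. (\<integral>y. f y \<partial>\<kappa> x) + (\<integral>y. g y \<partial>\<kappa> x) \<partial>M)"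
      using AE_int[OF add(1)] AE_int[OF add(3)] by (intro integral_cong_AE) auto
    also have "\<dots> = (\<integral>y. f y + g y \<partial>(M \<bind> \<kappa>))"
      using int_int[OF add(1)] int_int[OF add(3)] add by simp
    finally show ?case .
  next
    case (lim f s)
    then have [measurable]: "f \<in> borel_measurable B" "\<And>i. s i \<in> borel_measurable B" by (auto simp: sets_eq cong: measurable_cong_sets)
    have sp: "space (M \<bind> \<kappa>) = space B" by (rule sets_eq_imp_space_eq[OF sets_eq])
    have spk: "space (\<kappa> x) = space B" if "x \<in> space M" for x
      using subprob_measurableD(1)[OF \<kappa> that] .
    \<comment> \<open>The induction supplies approximations with norm at most twice that of
      \<open>f\<close>. Dominated convergence is used once for the composed measure and, for the
      iterated integral, once inside and once outside; the outer majorant is the inner integral of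
      \<open>2 * norm (f y)\<close>.\<close>
    have nint: "integrable (M \<bind> \<kappa>) (\<lambda>y. norm (f y))" using lim by auto
    show ?case
    proof (rule LIMSEQ_unique)
      show "(\<lambda>i. \<integral>y. s i y \<partial>(M \<bind> \<kappa>)) \<longlonglongrightarrow> (\<integral>y. f y \<partial>(M \<bind> \<kappa>))"
        by (rule integral_dominated_convergence[where w="\<lambda>y. 2 * norm (f y)"])
          (use lim nint in auto)
      have "(\<lambda>i. \<integral>x. \<integral>y. s i y \<partial>\<kappa> x \<partial>M) \<longlonglongrightarrow> (\<integral>x. \<integral>y. f y \<partial>\<kappa> x \<partial>M)"
      proof (rule integral_dominated_convergence[where w="\<lambda>x. \<integral>y. 2 * norm (f y) \<partial>\<kappa> x"])
        show "integrable M (\<lambda>x. \<integral>y. 2 * norm (f y) \<partial>\<kappa> x)"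
          by (rule int_int) (use nint in auto)
        show "AE x in M. (\<lambda>i. \<integral>y. s i y \<partial>\<kappa> x) \<longlonglongrightarrow> (\<integral>y. f y \<partial>\<kappa> x)"
          using AE_int[OF nint] AE_space
        proof eventually_elim
          case (elim x)
          note measurable_cong_sets[OF sets_kernel[OF \<kappa> elim(2)] refl, simp]
          show ?case
            by (rule integral_dominated_convergence[where w="\<lambda>y. 2 * norm (f y)"])
              (use lim elim spk sp in auto)
        qed
        show "AE x in M. norm (\<integral>y. s i y \<partial>\<kappa> x) \<le> (\<integral>y. 2 * norm (f y) \<partial>\<kappa> x)" for i
          using AE_int[OF nint] AE_int[OF lim(1)[of i]] AE_space
        proof eventually_elim
          case (elim x)
          have "norm (\<integral>y. s i y \<partial>\<kappa> x) \<le> (\<integral>y. norm (s i y) \<partial>\<kappa> x)"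
            by (rule integral_norm_bound)
          also have "\<dots> \<le> (\<integral>y. 2 * norm (f y) \<partial>\<kappa> x)"
            by (rule integral_mono) (use lim elim spk sp in auto)
          finally show ?case .
        qed
      qed measurable
      then show "(\<lambda>i. \<integral>y. s i y \<partial>(M \<bind> \<kappa>)) \<longlonglongrightarrow> (\<integral>x. \<integral>y. f y \<partial>\<kappa> x \<partial>M)"
        using lim(2) by simp
    qed
  qed
qed

context
  fixes M :: "'w measure" and S :: "'c measure" and N :: "'r measure"
    and X :: "'w \<Rightarrow> 'c" and Y :: "'w \<Rightarrow> 'r" and \<kappa> :: "'c \<Rightarrow> 'r measure"
  assumes M: "prob_space M" and XY: "(\<lambda>\<omega>. (X \<omega>, Y \<omega>)) \<in> M \<rightarrow>\<^sub>M S \<Otimes>\<^sub>M N"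
    and cond: "regular_cond_distr M S X N Y \<kappa>"
begin

interpretation prob_space M by (rule M)

text \<open>Attaching the point \<open>z\<close> to a draw from \<open>\<kappa> z\<close> turns the
  conditional law into a kernel on the product space, so that the joint law can be written as a
  composition.\<close>

lemma regular_cond_distr_kernel: "(\<lambda>z. distr (\<kappa> z) (S \<Otimes>\<^sub>M N) (Pair z)) \<in> S \<rightarrow>\<^sub>M subprob_algebra (S \<Otimes>\<^sub>M N)"
proof -
  have [measurable]: "\<kappa> \<in> S \<rightarrow>\<^sub>M subprob_algebra N"
    using cond by (auto simp: regular_cond_distr_def measurable_prob_algebraD)
  show ?thesis by (rule measurable_distr2) measurable
qed

text \<open>\<open>regular_cond_distr\<close> prescribes the joint law on rectangles only; these are
  stable under intersection and generate the product sigma-algebra, hence determine a finite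
  measure.\<close>

lemma joint_distr_eq_bind:
  "distr M (S \<Otimes>\<^sub>M N) (\<lambda>\<omega>. (X \<omega>, Y \<omega>))
    = distr M S X \<bind> (\<lambda>z. distr (\<kappa> z) (S \<Otimes>\<^sub>M N) (Pair z))"
  (is "?L = Giry_Monad.bind ?\<mu> ?k")
proof -
  have \<kappa>[measurable]: "\<kappa> \<in> S \<rightarrow>\<^sub>M subprob_algebra N"
    using cond by (auto simp: regular_cond_distr_def measurable_prob_algebraD)
  have X[measurable]: "X \<in> M \<rightarrow>\<^sub>M S" and Y[measurable]: "Y \<in> M \<rightarrow>\<^sub>M N"
    using measurable_compose[OF XY measurable_fst] measurable_compose[OF XY measurable_snd] by simp_all
  note regular_cond_distr_kernel[measurable]
  have ne: "space ?\<mu> \<noteq> {}"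
    using measurable_space[OF X] not_empty by auto
  have sets_bind': "sets (?\<mu> \<bind> ?k) = sets (S \<Otimes>\<^sub>M N)"
    using ne by (intro sets_bind) auto
  show ?thesis
  proof (rule measure_eqI_generator_eq[OF Int_stable_pair_measure_generator[of S N]])
    show "{a \<times> b |a b. a \<in> sets S \<and> b \<in> sets N} \<subseteq> Pow (space S \<times> space N)"
      by (rule pair_measure_closed)
    show "sets ?L = sigma_sets (space S \<times> space N) {a \<times> b |a b. a \<in> sets S \<and> b \<in> sets N}"
      by (simp add: sets_pair_measure)
    show "sets (?\<mu> \<bind> ?k) = sigma_sets (space S \<times> space N) {a \<times> b |a b. a \<in> sets S \<and> b \<in> sets N}"
      by (simp only: sets_bind' sets_pair_measure)
    show "range (\<lambda>i::nat. space S \<times> space N) \<subseteq> {a \<times> b |a b. a \<in> sets S \<and> b \<in> sets N}"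
      by auto
    show "(\<Union>i::nat. space S \<times> space N) = space S \<times> space N" by auto
    show "emeasure ?L (space S \<times> space N) \<noteq> \<infinity>"
      by (simp add: emeasure_distr emeasure_eq_measure)
  next
    fix A assume "A \<in> {a \<times> b |a b. a \<in> sets S \<and> b \<in> sets N}"
    then obtain a b where A: "A = a \<times> b" and a[measurable]: "a \<in> sets S" and b[measurable]: "b \<in> sets N"
      by auto
    have "emeasure (?\<mu> \<bind> ?k) A = (\<integral>\<^sup>+z. emeasure (?k z) A \<partial>?\<mu>)"
      using ne unfolding A by (intro emeasure_bind[where N="S \<Otimes>\<^sub>M N"]) auto
    also have "\<dots> = (\<integral>\<^sup>+z\<in>a. emeasure (\<kappa> z) b \<partial>?\<mu>)"
    proof (rule nn_integral_cong)
      fix z assume "z \<in> space ?\<mu>"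
      then have z: "z \<in> space S" by simp
      have [measurable_cong]: "sets (\<kappa> z) = sets N" using sets_kernel[OF \<kappa> z] .
      have sp: "space (\<kappa> z) = space N" using subprob_measurableD(1)[OF \<kappa> z] .
      have "emeasure (?k z) A = emeasure (\<kappa> z) (Pair z -` A \<inter> space (\<kappa> z))"
        unfolding A using z by (intro emeasure_distr) auto
      also have "Pair z -` A \<inter> space (\<kappa> z) = (if z \<in> a then b else {})"
        using sets.sets_into_space[OF b] by (auto simp: A sp)
      finally show "emeasure (?k z) A = emeasure (\<kappa> z) b * indicator a z"
        by auto
    qed
    also have "\<dots> = emeasure M {\<omega>\<in>space M. X \<omega> \<in> a \<and> Y \<omega> \<in> b}"
      using cond a b by (simp add: regular_cond_distr_def)
    also have "\<dots> = emeasure ?L A"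
      unfolding A by (subst emeasure_distr) (auto intro!: arg_cong[where f="emeasure M"])
    finally show "emeasure ?L A = emeasure (?\<mu> \<bind> ?k) A" by simp
  qed
qed

lemma nn_integral_regular_cond_distr:
  assumes f[measurable]: "f \<in> borel_measurable (S \<Otimes>\<^sub>M N)"
  shows "(\<integral>\<^sup>+p. f p \<partial>distr M (S \<Otimes>\<^sub>M N) (\<lambda>\<omega>. (X \<omega>, Y \<omega>))) = (\<integral>\<^sup>+z. \<integral>\<^sup>+y. f (z, y) \<partial>\<kappa> z \<partial>distr M S X)"
proof -
  have \<kappa>[measurable]: "\<kappa> \<in> S \<rightarrow>\<^sub>M subprob_algebra N"
    using cond by (auto simp: regular_cond_distr_def measurable_prob_algebraD)
  show ?thesis
    unfolding joint_distr_eq_bind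
    by (subst nn_integral_bind[where B="S \<Otimes>\<^sub>M N"])
      (auto intro!: nn_integral_cong nn_integral_distr regular_cond_distr_kernel
        simp: measurable_cong_sets[OF sets_kernel[OF \<kappa>] refl])
qed

text \<open>This vector-valued disintegration is what will make the weighted noise centred: the
  weight depends on the first coordinate alone, and the inner integral of the noise
  vanishes.\<close>

lemma integral_regular_cond_distr:
  fixes f :: "_ \<Rightarrow> 'b::{banach, second_countable_topology}"
  assumes f: "integrable (distr M (S \<Otimes>\<^sub>M N) (\<lambda>\<omega>. (X \<omega>, Y \<omega>))) f"
  shows "(\<integral>p. f p \<partial>distr M (S \<Otimes>\<^sub>M N) (\<lambda>\<omega>. (X \<omega>, Y \<omega>))) = (\<integral>z. \<integral>y. f (z, y) \<partial>\<kappa> z \<partial>distr M S X)"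
proof -
  have \<kappa>[measurable]: "\<kappa> \<in> S \<rightarrow>\<^sub>M subprob_algebra N"
    using cond by (auto simp: regular_cond_distr_def measurable_prob_algebraD)
  have X[measurable]: "X \<in> M \<rightarrow>\<^sub>M S"
    using measurable_compose[OF XY measurable_fst] by simp
  interpret D: prob_space "distr M S X" by (rule prob_space_distr) simp
  have fm[measurable]: "f \<in> borel_measurable (S \<Otimes>\<^sub>M N)"
    using borel_measurable_integrable[OF f] by simp
  have "(\<integral>p. f p \<partial>(distr M S X \<bind> (\<lambda>z. distr (\<kappa> z) (S \<Otimes>\<^sub>M N) (Pair z))))
      = (\<integral>z. \<integral>p. f p \<partial>distr (\<kappa> z) (S \<Otimes>\<^sub>M N) (Pair z) \<partial>distr M S X)"
    using f unfolding joint_distr_eq_bind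
    by (intro integral_kernel[symmetric, where B="S \<Otimes>\<^sub>M N"])
      (auto simp: D.not_empty D.finite_measure_axioms regular_cond_distr_kernel D.not_empty[simplified])
  also have "\<dots> = (\<integral>z. \<integral>y. f (z, y) \<partial>\<kappa> z \<partial>distr M S X)"
    by (intro Bochner_Integration.integral_cong refl integral_distr)
      (auto simp: measurable_cong_sets[OF sets_kernel[OF \<kappa>] refl])
  finally show ?thesis unfolding joint_distr_eq_bind .
qed

end

section \<open>Self-normalized sums in type 2 spaces\<close>

text \<open>\<open>type_two\<close> ranges over measures on \<open>nat \<Rightarrow> 'b\<close>. The
  joint law of the \<open>W i\<close> on the product over \<open>{1..n}\<close> is such a measure,
  its coordinates are again independent with the laws of the \<open>W i\<close>, and both sides of
  the inequality depend on the joint law alone.\<close>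

lemma type_two_indep_vars:
  assumes "type_two TYPE('b::{banach, second_countable_topology})"
  obtains c where "c > 0"
    and "\<And>(M :: 'w measure) (W :: nat \<Rightarrow> 'w \<Rightarrow> 'b) n. prob_space M \<Longrightarrow>
      prob_space.indep_vars M (\<lambda>_. borel) W {1..n} \<Longrightarrow>
      (\<And>i. i \<in> {1..n} \<Longrightarrow> integrable M (W i) \<and> integral\<^sup>L M (W i) = 0 \<and>
        integrable M (\<lambda>\<omega>. (norm (W i \<omega>))\<^sup>2)) \<Longrightarrow>
      (\<integral>\<omega>. (norm (\<Sum>i=1..n. W i \<omega>))\<^sup>2 \<partial>M) \<le> c * (\<Sum>i=1..n. \<integral>\<omega>. (norm (W i \<omega>))\<^sup>2 \<partial>M)"
proof -
  from assms obtain c where c: "c > 0" and type2: "\<forall>(P :: (nat \<Rightarrow> 'b) measure) (Z :: nat \<Rightarrow> (nat \<Rightarrow> 'b) \<Rightarrow> 'b) n.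
      prob_space P \<and> prob_space.indep_vars P (\<lambda>_. borel) Z {1..n} \<and>
      (\<forall>i\<in>{1..n}. integrable P (Z i) \<and> integral\<^sup>L P (Z i) = 0 \<and>
                   integrable P (\<lambda>\<omega>. (norm (Z i \<omega>))\<^sup>2)) \<longrightarrow>
      (\<integral>\<omega>. (norm (\<Sum>i=1..n. Z i \<omega>))\<^sup>2 \<partial>P) \<le> c * (\<Sum>i=1..n. \<integral>\<omega>. (norm (Z i \<omega>))\<^sup>2 \<partial>P)"
    unfolding type_two_def by (elim exE conjE)
  show thesis
  proof (rule that[OF c])
    fix M :: "'w measure" and W :: "nat \<Rightarrow> 'w \<Rightarrow> 'b" and n
    assume M: "prob_space M" and ind: "prob_space.indep_vars M (\<lambda>_. borel) W {1..n}"
      and W: "\<And>i. i \<in> {1..n} \<Longrightarrow> integrable M (W i) \<and> integral\<^sup>L M (W i) = 0 \<and>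
        integrable M (\<lambda>\<omega>. (norm (W i \<omega>))\<^sup>2)"
    interpret prob_space M by fact
    let ?I = "{1..n}"
    let ?B = "PiM ?I (\<lambda>_. borel :: 'b measure)"
    let ?V = "\<lambda>\<omega>. \<lambda>i\<in>?I. W i \<omega>"
    have Wm[measurable]: "W i \<in> borel_measurable M" if "i \<in> ?I" for i
      using W[OF that] by auto
    have V[measurable]: "?V \<in> M \<rightarrow>\<^sub>M ?B" by (intro measurable_restrict) auto
    define P where "P = distr M ?B ?V"
    interpret P: prob_space P unfolding P_def by (rule prob_space_distr) simp
    have sets_P[measurable_cong]: "sets P = sets ?B" by (simp add: P_def)
    have comp[measurable]: "(\<lambda>f. f i) \<in> borel_measurable ?B" if "i \<in> ?I" for i
      using that by (rule measurable_component_singleton)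
    \<comment> \<open>Independence is characterized by a product law over a nonempty index set; for
      \<open>n = 0\<close> it is vacuous.\<close>
    have indP: "P.indep_vars (\<lambda>_. borel) (\<lambda>i f. f i) ?I"
    proof (cases "?I = {}")
      case True
      then show ?thesis by (simp add: P.indep_vars_def P.indep_sets_def)
    next
      case False
      have "distr P ?B (\<lambda>f. \<lambda>i\<in>?I. f i) = distr M ?B ((\<lambda>f. \<lambda>i\<in>?I. f i) \<circ> ?V)"
        unfolding P_def by (intro distr_distr measurable_restrict) auto
      also have "\<dots> = distr M ?B ?V"
        by (intro distr_cong) (auto simp: fun_eq_iff)
      also have "\<dots> = PiM ?I (\<lambda>i. distr M borel (W i))"
        using ind False by (subst (asm) indep_vars_iff_distr_eq_PiM') auto
      also have "\<dots> = PiM ?I (\<lambda>i. distr P borel (\<lambda>f. f i))"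
      proof (intro PiM_cong refl)
        fix i assume i: "i \<in> ?I"
        have "distr P borel (\<lambda>f. f i) = distr M borel ((\<lambda>f. f i) \<circ> ?V)"
          unfolding P_def using i by (intro distr_distr) auto
        also have "\<dots> = distr M borel (W i)"
          using i by (intro distr_cong) auto
        finally show "distr M borel (W i) = distr P borel (\<lambda>f. f i)" by simp
      qed
      finally show ?thesis
        using False by (subst P.indep_vars_iff_distr_eq_PiM') auto
    qed
    have "(\<integral>f. (norm (\<Sum>i=1..n. f i))\<^sup>2 \<partial>P) \<le> c * (\<Sum>i=1..n. \<integral>f. (norm (f i))\<^sup>2 \<partial>P)"
    proof (intro type2[THEN spec, THEN spec, THEN spec, THEN mp] conjI ballI)
      show "prob_space P" by unfold_locales
      show "P.indep_vars (\<lambda>_. borel) (\<lambda>i f. f i) ?I" by (rule indP)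
    next
      fix i assume i: "i \<in> ?I"
      show "integrable P (\<lambda>f. f i)" "integral\<^sup>L P (\<lambda>f. f i) = 0" "integrable P (\<lambda>f. (norm (f i))\<^sup>2)"
        unfolding P_def using W[OF i] i by (simp_all add: integrable_distr_eq integral_distr)
    qed
    also have "(\<integral>f. (norm (\<Sum>i=1..n. f i))\<^sup>2 \<partial>P) = (\<integral>\<omega>. (norm (\<Sum>i=1..n. W i \<omega>))\<^sup>2 \<partial>M)"
    proof -
      have "(\<lambda>f. (norm (\<Sum>i=1..n. f i))\<^sup>2) \<in> borel_measurable ?B"
        by (intro borel_measurable_power borel_measurable_norm borel_measurable_sum comp) auto
      then show ?thesis unfolding P_def by (subst integral_distr) auto
    qed
    also have "(\<Sum>i=1..n. \<integral>f. (norm (f i))\<^sup>2 \<partial>P) = (\<Sum>i=1..n. \<integral>\<omega>. (norm (W i \<omega>))\<^sup>2 \<partial>M)"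
      unfolding P_def by (intro sum.cong refl) (simp add: integral_distr)
    finally show "(\<integral>\<omega>. (norm (\<Sum>i=1..n. W i \<omega>))\<^sup>2 \<partial>M) \<le> c * (\<Sum>i=1..n. \<integral>\<omega>. (norm (W i \<omega>))\<^sup>2 \<partial>M)" .
  qed
qed

text \<open>Convexity of the squared norm, obtained from Cauchy-Schwarz by splitting each weight
  into two square roots. If the weights sum to 0, both sides are 0 because division by 0 gives
  0.\<close>

lemma norm_weighted_mean_power2_le:
  fixes e :: "'i \<Rightarrow> 'b::real_normed_vector"
  assumes w: "\<And>i. i \<in> I \<Longrightarrow> 0 \<le> w i"
  shows "(norm ((\<Sum>i\<in>I. w i *\<^sub>R e i) /\<^sub>R (\<Sum>i\<in>I. w i)))\<^sup>2 \<le> (\<Sum>i\<in>I. w i / (\<Sum>i\<in>I. w i) * (norm (e i))\<^sup>2)"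
proof -
  define D where "D = (\<Sum>i\<in>I. w i)"
  have D: "D \<ge> 0" unfolding D_def by (intro sum_nonneg w)
  have "norm (\<Sum>i\<in>I. w i *\<^sub>R e i) \<le> (\<Sum>i\<in>I. w i * norm (e i))"
    by (rule order_trans[OF norm_sum]) (auto intro!: sum_mono simp: w)
  also have "\<dots> = (\<Sum>i\<in>I. sqrt (w i) * (sqrt (w i) * norm (e i)))"
    by (intro sum.cong refl) (simp add: w flip: mult.assoc real_sqrt_mult)
  finally have "(norm (\<Sum>i\<in>I. w i *\<^sub>R e i))\<^sup>2 \<le> (\<Sum>i\<in>I. sqrt (w i) * (sqrt (w i) * norm (e i)))\<^sup>2"
    by (intro power_mono) auto
  also have "\<dots> \<le> (\<Sum>i\<in>I. (sqrt (w i))\<^sup>2) * (\<Sum>i\<in>I. (sqrt (w i) * norm (e i))\<^sup>2)"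
    by (rule Cauchy_Schwarz_ineq_sum)
  also have "\<dots> = D * (\<Sum>i\<in>I. w i * (norm (e i))\<^sup>2)"
    by (simp add: w power_mult_distrib D_def)
  finally have *: "(norm (\<Sum>i\<in>I. w i *\<^sub>R e i))\<^sup>2 \<le> D * (\<Sum>i\<in>I. w i * (norm (e i))\<^sup>2)" .
  have "(norm ((\<Sum>i\<in>I. w i *\<^sub>R e i) /\<^sub>R D))\<^sup>2 = (norm (\<Sum>i\<in>I. w i *\<^sub>R e i))\<^sup>2 / D\<^sup>2"
    using D by (simp add: power_mult_distrib divide_inverse mult.commute power_inverse)
  also have "\<dots> \<le> D * (\<Sum>i\<in>I. w i * (norm (e i))\<^sup>2) / D\<^sup>2"
    by (intro divide_right_mono *) auto
  also have "\<dots> = (\<Sum>i\<in>I. w i / D * (norm (e i))\<^sup>2)"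
    by (cases "D = 0") (simp_all add: power2_eq_square sum_divide_distrib)
  finally show ?thesis unfolding D_def .
qed

lemma (in prob_space) indep_var_nn_integral:
  fixes X1 X2 :: "'a \<Rightarrow> ennreal"
  assumes "indep_var borel X1 borel X2"
  shows "(\<integral>\<^sup>+\<omega>. X1 \<omega> * X2 \<omega> \<partial>M) = (\<integral>\<^sup>+\<omega>. X1 \<omega> \<partial>M) * (\<integral>\<^sup>+\<omega>. X2 \<omega> \<partial>M)"
proof -
  have "(\<lambda>_. borel) = case_bool borel (borel :: ennreal measure)"
    by (auto simp: fun_eq_iff split: bool.split)
  with assms have "indep_vars (\<lambda>_. borel) (case_bool X1 X2) UNIV"
    by (simp add: indep_var_def)
  from indep_vars_nn_integral[OF _ this] show ?thesis
    by (simp add: UNIV_bool mult.commute)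
qed

text \<open>The blocks \<open>{i}\<close> and \<open>A\<close> are disjoint, hence independent. With
  nonnegative integrals, second moments can be factored before their finiteness is known.\<close>

lemma (in prob_space) indep_vars_nn_integral_rest:
  fixes f :: "'b \<Rightarrow> ennreal"
  assumes ind: "indep_vars M' U I" and i: "i \<in> I" and A: "A \<subseteq> I - {i}"
    and f: "f \<in> borel_measurable (M' i)" and g: "g \<in> borel_measurable (PiM A M')"
  shows "(\<integral>\<^sup>+\<omega>. f (U i \<omega>) * g (\<lambda>j\<in>A. U j \<omega>) \<partial>M) =
    (\<integral>\<^sup>+\<omega>. f (U i \<omega>) \<partial>M) * (\<integral>\<^sup>+\<omega>. g (\<lambda>j\<in>A. U j \<omega>) \<partial>M)"
proof -
  have "indep_var (PiM {i} M') (\<lambda>\<omega>. \<lambda>j\<in>{i}. U j \<omega>) (PiM A M') (\<lambda>\<omega>. \<lambda>j\<in>A. U j \<omega>)"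
    using i A by (intro indep_var_restrict[OF ind]) auto
  then have "indep_var borel ((\<lambda>u. f (u i)) \<circ> (\<lambda>\<omega>. \<lambda>j\<in>{i}. U j \<omega>)) borel (g \<circ> (\<lambda>\<omega>. \<lambda>j\<in>A. U j \<omega>))"
  proof (rule indep_var_compose)
    show "(\<lambda>u. f (u i)) \<in> borel_measurable (PiM {i} M')"
      by (rule measurable_compose[where N="M' i", OF _ f]) simp
  qed (rule g)
  from indep_var_nn_integral[OF this] show ?thesis by simp
qed

text \<open>Exponential Markov inequality for 2 to the power of minus the count. As
  \<open>1 - p / 2\<close> is at most \<open>exp (- (p / 2))\<close>, it gives
  \<open>exp (- ((1 - ln 2) * (n * p) / 2))\<close>; this is the origin of the constant
  \<open>1 - ln 2\<close>.\<close>

lemma (in prob_space) prob_count_less_half_mean: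
  fixes J :: "nat \<Rightarrow> 'a \<Rightarrow> real"
  assumes ind: "indep_vars (\<lambda>_. borel) J {1..n}"
    and J: "\<And>i \<omega>. J i \<omega> \<in> {0, 1}" and EJ: "\<And>i. i \<in> {1..n} \<Longrightarrow> expectation (J i) = p"
    and np: "n \<ge> 1" "p > 0"
  shows "prob {\<omega>\<in>space M. (\<Sum>i=1..n. J i \<omega>) < n * p / 2} \<le> 2 / ((1 - ln 2) * (n * p))"
proof -
  let ?s = "n * p / 2" and ?N = "\<lambda>\<omega>. \<Sum>i=1..n. J i \<omega>"
  have Jm[measurable]: "J i \<in> borel_measurable M" if "i \<in> {1..n}" for i
    using ind that by (auto simp: indep_vars_def)
  have J01: "0 \<le> J i \<omega>" "J i \<omega> \<le> 1" for i \<omega>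
    using J[of i \<omega>] by auto
  have Jint: "integrable M (J i)" if "i \<in> {1..n}" for i
    by (rule integrable_const_bound[where B=1]) (use that J01 Jm in auto)
  \<comment> \<open>This makes \<open>1 - p / 2\<close> nonnegative, so that its comparison with the
    exponential may be raised to the power \<open>n\<close>.\<close>
  have p1: "p \<le> 1"
  proof -
    have "expectation (J 1) \<le> 1"
      using np J01 by (intro integral_le_const Jint AE_I2) auto
    then show ?thesis using EJ[of 1] np by simp
  qed
  have ind2: "indep_vars (\<lambda>_. borel) (\<lambda>i \<omega>. 1 - J i \<omega> / 2) {1..n}"
    by (rule indep_vars_compose2[OF ind]) simp
  \<comment> \<open>On the values 0 and 1 the exponential is an affine function, so its expectation
    is exactly \<open>1 - p / 2\<close>.\<close>
  have prod: "(\<Prod>i=1..n. 1 - J i \<omega> / 2) = 2 powr - ?N \<omega>" for \<omega>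
  proof -
    have "(1 - J i \<omega> / 2) = 2 powr - J i \<omega>" for i
      using J[of i \<omega>] by (auto simp: powr_minus)
    then have "(\<Prod>i=1..n. 1 - J i \<omega> / 2) = (\<Prod>i=1..n. 2 powr - J i \<omega>)" by simp
    also have "\<dots> = 2 powr (\<Sum>i=1..n. - J i \<omega>)" by (rule powr_sum[symmetric]) simp
    finally show ?thesis by (simp add: sum_negf)
  qed
  have int2: "integrable M (\<lambda>\<omega>. 1 - J i \<omega> / 2)" if "i \<in> {1..n}" for i using Jint[OF that] by simp
  have E: "expectation (\<lambda>\<omega>. 2 powr - ?N \<omega>) = (1 - p / 2) ^ n"
  proof -
    have "expectation (\<lambda>\<omega>. 2 powr - ?N \<omega>) = (\<Prod>i=1..n. expectation (\<lambda>\<omega>. 1 - J i \<omega> / 2))"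
      unfolding prod[symmetric] by (rule indep_vars_lebesgue_integral[OF _ ind2 int2]) auto
    also have "\<dots> = (\<Prod>i=1..n. 1 - p / 2)"
      using EJ Jint by (intro prod.cong refl) (simp add: prob_space)
    finally show ?thesis by simp
  qed
  have int: "integrable M (\<lambda>\<omega>. 2 powr - ?N \<omega>)"
    unfolding prod[symmetric] by (rule indep_vars_integrable[OF _ ind2 int2]) auto
  have "prob {\<omega>\<in>space M. ?N \<omega> < ?s} \<le> prob {\<omega>\<in>space M. 2 powr - ?N \<omega> \<ge> 2 powr - ?s}"
  proof (rule finite_measure_mono)
    have [measurable]: "?N \<in> borel_measurable M" by (intro borel_measurable_sum Jm)
    show "{\<omega>\<in>space M. 2 powr - ?N \<omega> \<ge> 2 powr - ?s} \<in> sets M" by measurable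
  qed auto
  also have "\<dots> \<le> expectation (\<lambda>\<omega>. 2 powr - ?N \<omega>) / 2 powr - ?s"
    by (rule integral_Markov_inequality_measure[OF int, where A="space M"]) (auto)
  also have "\<dots> = 2 powr ?s * (1 - p / 2) ^ n" unfolding E by (simp only: powr_minus divide_inverse inverse_inverse_eq mult.commute)
  also have "\<dots> \<le> 2 powr ?s * exp (- (p / 2)) ^ n"
    using p1 exp_ge_add_one_self[of "- (p/2)"] by (intro mult_left_mono power_mono) auto
  also have "\<dots> = exp (- ((1 - ln 2) * (n * p) / 2))"
  proof -
    have "2 powr ?s * exp (- (p / 2)) ^ n = exp (?s * ln 2 + n * - (p / 2))"
      by (simp only: powr_def exp_of_nat_mult[symmetric] exp_add) simp
    also have "?s * ln 2 + n * - (p / 2) = - ((1 - ln 2) * (n * p) / 2)"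
      by (simp add: field_simps)
    finally show ?thesis .
  qed
  also have "\<dots> \<le> 2 / ((1 - ln 2) * (n * p))"
  proof -
    \<comment> \<open>Exponential decay is given up for \<open>1 / y\<close>, since the other error
      terms are of order \<open>1 / (n * p)\<close> anyway.\<close>
    define y where "y = (1 - ln 2) * (n * p) / 2"
    have "y > 0" unfolding y_def using np ln_2_less_1 by simp
    have "y \<le> exp y" using exp_ge_add_one_self[of y] by linarith
    then have "exp (- y) \<le> 1 / y" using \<open>y > 0\<close> by (simp add: exp_minus divide_simps)
    then show ?thesis by (simp add: y_def)
  qed
  finally show ?thesis .
qed

lemma norm_sum_power2_le:
  fixes e :: "'i \<Rightarrow> 'b::real_normed_vector"
  shows "(norm (\<Sum>i\<in>I. e i))\<^sup>2 \<le> card I * (\<Sum>i\<in>I. (norm (e i))\<^sup>2)"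
proof -
  have "(norm (\<Sum>i\<in>I. e i))\<^sup>2 \<le> (\<Sum>i\<in>I. 1 * norm (e i))\<^sup>2"
    using norm_sum[of e I] by (intro power_mono) auto
  also have "\<dots> \<le> (\<Sum>i\<in>I. 1\<^sup>2) * (\<Sum>i\<in>I. (norm (e i))\<^sup>2)"
    by (rule Cauchy_Schwarz_ineq_sum)
  finally show ?thesis by simp
qed

text \<open>
  \<open>H i\<close> only involves the indices other than \<open>i\<close>, so that it will be independent of \<open>w i\<close> and
  \<open>e i\<close>; where \<open>J i = 1\<close> it coincides with \<open>1 / (\<Sum>j\<in>I. J j)\<close> cut off at \<open>s\<close>.
\<close>

lemma self_normalized_split:
  fixes e :: "'i \<Rightarrow> 'b::real_normed_vector" and w :: "'i \<Rightarrow> real"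
  assumes I: "finite I" and k: "0 < k_lo" "k_lo \<le> k_hi" and s: "0 < s"
    and w: "\<And>i. i \<in> I \<Longrightarrow> w i = 0 \<or> (k_lo \<le> w i \<and> w i \<le> k_hi)"
  defines "J \<equiv> \<lambda>i. of_bool (w i > 0)"
  defines "H \<equiv> \<lambda>i. of_bool (1 + (\<Sum>j\<in>I-{i}. J j) < s) / (1 + (\<Sum>j\<in>I-{i}. J j))"
  shows "(norm ((\<Sum>i\<in>I. w i *\<^sub>R e i) /\<^sub>R (\<Sum>i\<in>I. w i)))\<^sup>2 \<le>
    (1 / (k_lo * s))\<^sup>2 * (norm (\<Sum>i\<in>I. w i *\<^sub>R e i))\<^sup>2 +
    k_hi / k_lo * (\<Sum>i\<in>I. J i * (norm (e i))\<^sup>2 * H i)" (is "?l \<le> ?a + ?b")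
    and "(\<Sum>i\<in>I. J i * H i) \<le> of_bool ((\<Sum>i\<in>I. J i) < s)"
proof -
  define N where "N = (\<Sum>i\<in>I. J i)"
  define D where "D = (\<Sum>i\<in>I. w i)"
  have J: "J i \<ge> 0" for i by (simp add: J_def)
  have wJ: "k_lo * J i \<le> w i" "w i \<le> k_hi * J i" "w i \<ge> 0" if "i \<in> I" for i
    using w[OF that] k by (auto simp: J_def)
  have D: "k_lo * N \<le> D" "0 \<le> D"
    unfolding N_def D_def sum_distrib_left using wJ by (auto intro!: sum_mono sum_nonneg)
  have N0: "N \<ge> 0" unfolding N_def by (intro sum_nonneg J)
  have JH: "J i * H i = J i * of_bool (N < s) / N" if "i \<in> I" for i
  proof (cases "J i = 0")
    case False
    then have "J i = 1" by (simp add: J_def split: if_splits)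
    then have "1 + (\<Sum>j\<in>I-{i}. J j) = N"
      unfolding N_def using that I by (simp add: sum.remove)
    then show ?thesis by (simp add: H_def)
  qed auto
  have "(\<Sum>i\<in>I. J i * H i) = (\<Sum>i\<in>I. J i * of_bool (N < s) / N)"
    by (intro sum.cong refl JH)
  also have "\<dots> = N * of_bool (N < s) / N"
    by (simp add: N_def sum_divide_distrib sum_distrib_right)
  \<comment> \<open>Equality fails at \<open>N = 0\<close>, where the quotient is 0 by convention
    while the indicator is 1.\<close>
  also have "\<dots> \<le> of_bool (N < s)" by simp
  finally show "(\<Sum>i\<in>I. J i * H i) \<le> of_bool ((\<Sum>i\<in>I. J i) < s)" by (simp add: N_def)
  have a0: "?a \<ge> 0" by simp
  have H: "H i \<ge> 0" for i by (simp add: H_def sum_nonneg J)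
  have kh: "k_hi \<ge> 0" using k by linarith
  have b0: "?b \<ge> 0"
    using kh k by (auto intro!: mult_nonneg_nonneg sum_nonneg divide_nonneg_pos simp: J H)
  \<comment> \<open>For \<open>N \<ge> s\<close> the denominator is at least \<open>k_lo * s\<close>
    and is replaced by this constant. For \<open>N < s\<close> convexity leaves the weights
    \<open>w i / D\<close>, each at most \<open>k_hi / k_lo\<close> times \<open>J i * H i\<close>,
    because \<open>D \<ge> k_lo * N\<close>.\<close>
  show "?l \<le> ?a + ?b"
  proof (cases "N < s")
    case False
    then have "0 < k_lo * s" "k_lo * s \<le> D" using s k order_trans[OF mult_left_mono D(1), of s] by auto
    then have "inverse D \<le> 1 / (k_lo * s)" by (simp add: divide_simps)
    then have "?l \<le> ((1 / (k_lo * s)) * norm (\<Sum>i\<in>I. w i *\<^sub>R e i))\<^sup>2"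
      using D mult_right_mono[of "inverse D" "1 / (k_lo * s)" "norm (\<Sum>i\<in>I. w i *\<^sub>R e i)"]
      unfolding D_def[symmetric] by (intro power_mono) auto
    then show ?thesis using b0 by (simp add: power_mult_distrib[of "1 / (k_lo * s)"] del: power_divide times_divide_eq_left)
  next
    case True
    have "?l \<le> (\<Sum>i\<in>I. w i / D * (norm (e i))\<^sup>2)"
      unfolding D_def using wJ by (intro norm_weighted_mean_power2_le)
    also have "\<dots> \<le> (\<Sum>i\<in>I. k_hi / k_lo * (J i * (norm (e i))\<^sup>2 * H i))"
    proof (rule sum_mono)
      fix i assume i: "i \<in> I"
      have "w i / D \<le> k_hi / k_lo * (J i * H i)"
      proof (cases "w i = 0")
        case False
        then have Ji: "J i = 1" using wJ[OF i] by (simp add: J_def)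
        have "J i \<le> N" unfolding N_def using i I J by (intro member_le_sum) auto
        then have N: "N > 0" using Ji by simp
        have "w i / D \<le> k_hi / (k_lo * N)"
          using wJ[OF i] D N k Ji by (intro frac_le) auto
        then show ?thesis using JH[OF i] True Ji by simp
      next
        case True
        then show ?thesis using kh i k by (auto intro!: mult_nonneg_nonneg simp: J H)
      qed
      from mult_right_mono[OF this, of "(norm (e i))\<^sup>2"]
      show "w i / D * (norm (e i))\<^sup>2 \<le> k_hi / k_lo * (J i * (norm (e i))\<^sup>2 * H i)"
        by (simp add: mult_ac)
    qed
    also have "\<dots> = ?b" by (simp add: sum_distrib_left)
    finally show ?thesis using a0 by linarith
  qed
qed

text \<open>\<open>v\<close> bounds the second moment of the noise given a positive weight. In the
  split at \<open>s = n * p / 2\<close>, the numerator has second moment at most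
  \<open>c * k_hi\<^sup>2 * v * (n * p)\<close>, and division by \<open>(k_lo * s)\<^sup>2\<close>
  gives the first constant; the second is \<open>k_hi / k_lo * v\<close> times the tail bound for
  the count.\<close>

lemma (in prob_space) self_normalized_second_moment:
  fixes w :: "nat \<Rightarrow> 'a \<Rightarrow> real" and e :: "nat \<Rightarrow> 'a \<Rightarrow> 'b::{banach, second_countable_topology}"
  assumes type2: "\<And>W :: nat \<Rightarrow> 'a \<Rightarrow> 'b. indep_vars (\<lambda>_. borel) W {1..n} \<Longrightarrow>
      (\<And>i. i \<in> {1..n} \<Longrightarrow> integrable M (W i) \<and> integral\<^sup>L M (W i) = 0 \<and>
        integrable M (\<lambda>\<omega>. (norm (W i \<omega>))\<^sup>2)) \<Longrightarrow>
      (\<integral>\<omega>. (norm (\<Sum>i=1..n. W i \<omega>))\<^sup>2 \<partial>M) \<le> c * (\<Sum>i=1..n. \<integral>\<omega>. (norm (W i \<omega>))\<^sup>2 \<partial>M)"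
    and c: "c > 0" and k: "0 < k_lo" "k_lo \<le> k_hi" and n: "n \<ge> 1" and p: "p > 0" and v: "v \<ge> 0"
    and ind: "indep_vars (\<lambda>_. borel) (\<lambda>i \<omega>. (w i \<omega>, e i \<omega>)) {1..n}"
    and w: "\<And>i \<omega>. w i \<omega> = 0 \<or> (k_lo \<le> w i \<omega> \<and> w i \<omega> \<le> k_hi)"
    and prob_pos: "\<And>i. i \<in> {1..n} \<Longrightarrow> prob {\<omega>\<in>space M. w i \<omega> > 0} = p"
    and mean: "\<And>i. i \<in> {1..n} \<Longrightarrow> expectation (\<lambda>\<omega>. w i \<omega> *\<^sub>R e i \<omega>) = 0"
    and var: "\<And>i. i \<in> {1..n} \<Longrightarrow>
      (\<integral>\<^sup>+\<omega>. of_bool (w i \<omega> > 0) * ennreal ((norm (e i \<omega>))\<^sup>2) \<partial>M) \<le> ennreal (v * p)"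
  shows "(\<integral>\<^sup>+\<omega>. ennreal ((norm ((\<Sum>i=1..n. w i \<omega> *\<^sub>R e i \<omega>) /\<^sub>R (\<Sum>i=1..n. w i \<omega>)))\<^sup>2) \<partial>M)
    \<le> ennreal ((4 * c * k_hi\<^sup>2 * v / k_lo\<^sup>2 + 2 * k_hi * v / (k_lo * (1 - ln 2))) / (n * p))"
proof -
  let ?I = "{1..n}"
  have [measurable]: "fst \<in> borel \<rightarrow>\<^sub>M (borel :: real measure)" "snd \<in> borel \<rightarrow>\<^sub>M (borel :: 'b measure)"
    by (intro borel_measurable_continuous_onI continuous_intros)+
  define s where "s = n * p / 2"
  have s: "s > 0" using n p by (simp add: s_def)
  define J where "J i \<omega> = (of_bool (w i \<omega> > 0) :: real)" for i \<omega>
  define H where "H i \<omega> = (of_bool (1 + (\<Sum>j\<in>?I-{i}. J j \<omega>) < s) / (1 + (\<Sum>j\<in>?I-{i}. J j \<omega>)))" for i \<omega>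
  have rv: "(\<lambda>\<omega>. (w i \<omega>, e i \<omega>)) \<in> borel_measurable M" if "i \<in> ?I" for i
    using ind that by (auto simp: indep_vars_def)
  have wm[measurable]: "w i \<in> borel_measurable M" and em[measurable]: "e i \<in> borel_measurable M"
    if "i \<in> ?I" for i
    using measurable_compose[OF rv[OF that], of fst] measurable_compose[OF rv[OF that], of snd]
    by (simp_all add: borel_prod[symmetric])
  have J0: "J i \<omega> \<ge> 0" for i \<omega> by (simp add: J_def)
  have H0: "H i \<omega> \<ge> 0" for i \<omega> by (simp add: H_def sum_nonneg J0)
  have Jm[measurable]: "J i \<in> borel_measurable M" if "i \<in> ?I" for i
    using wm[OF that] unfolding J_def by measurable
  have Hm[measurable]: "H i \<in> borel_measurable M" if "i \<in> ?I" for i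
  proof -
    have [measurable]: "(\<lambda>\<omega>. \<Sum>j\<in>?I-{i}. J j \<omega>) \<in> borel_measurable M"
      by (intro borel_measurable_sum Jm) auto
    show ?thesis unfolding H_def by measurable
  qed
  have kh: "k_hi > 0" using k by linarith
  define W where "W i \<omega> = w i \<omega> *\<^sub>R e i \<omega>" for i \<omega>
  have Wm[measurable]: "W i \<in> borel_measurable M" if "i \<in> ?I" for i
    using wm[OF that] em[OF that] unfolding W_def by measurable
  have wabs: "(norm (W i \<omega>))\<^sup>2 \<le> k_hi\<^sup>2 * (J i \<omega> * (norm (e i \<omega>))\<^sup>2)" for i \<omega>
    using w[of i \<omega>] k by (auto simp: W_def J_def power_mult_distrib intro!: mult_right_mono power_mono)
  have var': "(\<integral>\<^sup>+\<omega>. ennreal (J i \<omega> * (norm (e i \<omega>))\<^sup>2) \<partial>M) \<le> ennreal (v * p)" if "i \<in> ?I" for i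
  proof -
    have "ennreal (J i \<omega> * (norm (e i \<omega>))\<^sup>2) = of_bool (w i \<omega> > 0) * ennreal ((norm (e i \<omega>))\<^sup>2)" for \<omega>
      by (simp add: J_def)
    then show ?thesis using var[OF that] by simp
  qed
  have W2: "(\<integral>\<^sup>+\<omega>. ennreal ((norm (W i \<omega>))\<^sup>2) \<partial>M) \<le> ennreal (k_hi\<^sup>2 * (v * p))" if i: "i \<in> ?I" for i
  proof -
    have "(\<integral>\<^sup>+\<omega>. ennreal ((norm (W i \<omega>))\<^sup>2) \<partial>M) \<le> (\<integral>\<^sup>+\<omega>. ennreal (k_hi\<^sup>2) * ennreal (J i \<omega> * (norm (e i \<omega>))\<^sup>2) \<partial>M)"
      using wabs J0 by (intro nn_integral_mono) (auto simp: ennreal_mult[symmetric] intro!: ennreal_leI)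
    also have "\<dots> = ennreal (k_hi\<^sup>2) * (\<integral>\<^sup>+\<omega>. ennreal (J i \<omega> * (norm (e i \<omega>))\<^sup>2) \<partial>M)"
      using i by (intro nn_integral_cmult) auto
    also have "\<dots> \<le> ennreal (k_hi\<^sup>2) * ennreal (v * p)"
      by (intro mult_left_mono var' i) auto
    finally show ?thesis using v p by (simp add: ennreal_mult)
  qed
  have intW2: "integrable M (\<lambda>\<omega>. (norm (W i \<omega>))\<^sup>2)" if i: "i \<in> ?I" for i
    using i le_less_trans[OF W2[OF i] ennreal_less_top] by (intro integrableI_bounded) auto
  have intW: "integrable M (W i)" if i: "i \<in> ?I" for i
  proof -
    have "integrable M (\<lambda>\<omega>. norm (W i \<omega>))"
      using i by (intro square_integrable_imp_integrable[OF _ intW2[OF i]]) auto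
    then show ?thesis using i by (subst (asm) integrable_norm_iff) auto
  qed
  have EW2: "expectation (\<lambda>\<omega>. (norm (W i \<omega>))\<^sup>2) \<le> k_hi\<^sup>2 * (v * p)" if i: "i \<in> ?I" for i
  proof -
    have "ennreal (expectation (\<lambda>\<omega>. (norm (W i \<omega>))\<^sup>2)) \<le> ennreal (k_hi\<^sup>2 * (v * p))"
      using W2[OF i] by (subst nn_integral_eq_integral[symmetric, OF intW2[OF i]]) auto
    then show ?thesis using v p by (subst (asm) ennreal_le_iff) auto
  qed
  let ?S = "\<lambda>\<omega>. \<Sum>i=1..n. W i \<omega>"
  have Sm[measurable]: "?S \<in> borel_measurable M"
    by (intro borel_measurable_sum Wm)
  have "expectation (\<lambda>\<omega>. (norm (?S \<omega>))\<^sup>2) \<le> c * (\<Sum>i=1..n. expectation (\<lambda>\<omega>. (norm (W i \<omega>))\<^sup>2))"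
  proof (rule type2)
    have "(\<lambda>u. fst u *\<^sub>R snd u) \<in> borel \<rightarrow>\<^sub>M (borel :: 'b measure)"
      unfolding borel_prod[symmetric] by measurable
    from indep_vars_compose2[OF ind this]
    show "indep_vars (\<lambda>_. borel) W ?I" by (simp add: W_def[abs_def])
    show "integrable M (W i) \<and> integral\<^sup>L M (W i) = 0 \<and> integrable M (\<lambda>\<omega>. (norm (W i \<omega>))\<^sup>2)"
      if "i \<in> ?I" for i
      using intW[OF that] intW2[OF that] mean[OF that] by (simp add: W_def[abs_def])
  qed
  also have "\<dots> \<le> c * (\<Sum>i=1..n. k_hi\<^sup>2 * (v * p))"
    using c by (intro mult_left_mono sum_mono EW2) auto
  finally have ES: "expectation (\<lambda>\<omega>. (norm (?S \<omega>))\<^sup>2) \<le> c * k_hi\<^sup>2 * v * (n * p)"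
    by (simp add: mult_ac)
  \<comment> \<open>\<open>ES\<close> bounds a Bochner integral, which would be 0 for a
    non-integrable square; integrability turns it into a bound for the nonnegative integral.\<close>
  have intS: "integrable M (\<lambda>\<omega>. (norm (?S \<omega>))\<^sup>2)"
  proof (rule Bochner_Integration.integrable_bound)
    show "integrable M (\<lambda>\<omega>. card ?I * (\<Sum>i=1..n. (norm (W i \<omega>))\<^sup>2))"
      using intW2 by (intro integrable_mult_right Bochner_Integration.integrable_sum)
    show "AE \<omega> in M. norm ((norm (?S \<omega>))\<^sup>2) \<le> norm (card ?I * (\<Sum>i=1..n. (norm (W i \<omega>))\<^sup>2))"
      using norm_sum_power2_le[of "\<lambda>i. W i _" ?I]
      by (intro AE_I2) (auto simp: abs_of_nonneg sum_nonneg intro: order_trans)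
  qed measurable
  have nnS: "(\<integral>\<^sup>+\<omega>. ennreal ((norm (?S \<omega>))\<^sup>2) \<partial>M) \<le> ennreal (c * k_hi\<^sup>2 * v * (n * p))"
    using ES by (subst nn_integral_eq_integral[OF intS]) (auto intro: ennreal_leI)

  \<comment> \<open>\<open>H i\<close> is a function of the pairs with index other than
    \<open>i\<close>, hence independent of the pair with index \<open>i\<close>.\<close>
  have fact: "(\<integral>\<^sup>+\<omega>. f (w i \<omega>, e i \<omega>) * ennreal (H i \<omega>) \<partial>M) =
      (\<integral>\<^sup>+\<omega>. f (w i \<omega>, e i \<omega>) \<partial>M) * (\<integral>\<^sup>+\<omega>. ennreal (H i \<omega>) \<partial>M)"
    if i: "i \<in> ?I" and f: "f \<in> borel_measurable borel" for i and f :: "real \<times> 'b \<Rightarrow> ennreal"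
  proof -
    let ?A = "?I - {i}"
    define N where "N u = (\<Sum>j\<in>?A. (of_bool (fst (u j) > 0) :: real))" for u :: "nat \<Rightarrow> real \<times> 'b"
    define g where "g u = ennreal (of_bool (1 + N u < s) / (1 + N u))" for u
    have gm: "g \<in> borel_measurable (PiM ?A (\<lambda>_. borel))"
    proof -
      have "(\<lambda>u. of_bool (fst (u j :: real \<times> 'b) > 0) :: real) \<in> borel_measurable (PiM ?A (\<lambda>_. borel))"
        if "j \<in> ?A" for j
      proof -
        have [measurable]: "(\<lambda>u. fst (u j :: real \<times> 'b)) \<in> borel_measurable (PiM ?A (\<lambda>_. borel))"
          by (rule measurable_compose[where N=borel]) (use that in auto)
        show ?thesis by measurable
      qed
      then have [measurable]: "N \<in> borel_measurable (PiM ?A (\<lambda>_. borel))"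
        unfolding N_def by (intro borel_measurable_sum)
      show ?thesis unfolding g_def by measurable
    qed
    have g: "g (\<lambda>j\<in>?A. (w j \<omega>, e j \<omega>)) = ennreal (H i \<omega>)" for \<omega>
      by (simp add: g_def N_def H_def J_def)
    show ?thesis
      using indep_vars_nn_integral_rest[OF ind i subset_refl f gm] by (simp only: g)
  qed
  \<comment> \<open>After factoring, the noise moment is bounded by \<open>v * p\<close>; then
    \<open>p\<close> is rewritten as the expectation of \<open>J i\<close> and recombined with
    \<open>H i\<close> by independence. The noise is thus replaced by the constant \<open>v\<close>
    while the factor \<open>J i\<close> survives.\<close>
  have cross: "(\<integral>\<^sup>+\<omega>. ennreal (J i \<omega> * (norm (e i \<omega>))\<^sup>2 * H i \<omega>) \<partial>M) \<le> ennreal v * (\<integral>\<^sup>+\<omega>. ennreal (J i \<omega> * H i \<omega>) \<partial>M)"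
    if i: "i \<in> ?I" for i
  proof -
    have 1: "(\<lambda>u::real \<times> 'b. ennreal (of_bool (fst u > 0) * (norm (snd u))\<^sup>2)) \<in> borel_measurable borel"
      unfolding borel_prod[symmetric] by measurable
    have 2: "(\<lambda>u::real \<times> 'b. ennreal (of_bool (fst u > 0))) \<in> borel_measurable borel"
      unfolding borel_prod[symmetric] by measurable
    have "(\<integral>\<^sup>+\<omega>. ennreal (J i \<omega> * (norm (e i \<omega>))\<^sup>2 * H i \<omega>) \<partial>M) =
      (\<integral>\<^sup>+\<omega>. ennreal (J i \<omega> * (norm (e i \<omega>))\<^sup>2) \<partial>M) * (\<integral>\<^sup>+\<omega>. ennreal (H i \<omega>) \<partial>M)"
      using fact[OF i 1] by (simp add: J_def ennreal_mult' H0)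
    also have "\<dots> \<le> ennreal (v * p) * (\<integral>\<^sup>+\<omega>. ennreal (H i \<omega>) \<partial>M)"
      by (intro mult_right_mono var' i) auto
    also have "ennreal p = (\<integral>\<^sup>+\<omega>. ennreal (J i \<omega>) \<partial>M)"
    proof -
      have "(\<integral>\<^sup>+\<omega>. ennreal (J i \<omega>) \<partial>M) = (\<integral>\<^sup>+\<omega>. indicator {\<omega>\<in>space M. w i \<omega> > 0} \<omega> \<partial>M)"
        by (intro nn_integral_cong) (auto simp: J_def)
      also have "\<dots> = ennreal p"
        using i prob_pos[OF i] by (subst nn_integral_indicator) (auto simp: emeasure_eq_measure)
      finally show ?thesis ..
    qed
    then have "ennreal (v * p) * (\<integral>\<^sup>+\<omega>. ennreal (H i \<omega>) \<partial>M) =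
        ennreal v * ((\<integral>\<^sup>+\<omega>. ennreal (J i \<omega>) \<partial>M) * (\<integral>\<^sup>+\<omega>. ennreal (H i \<omega>) \<partial>M))"
      using v p by (simp add: ennreal_mult mult_ac)
    also have "\<dots> = ennreal v * (\<integral>\<^sup>+\<omega>. ennreal (J i \<omega> * H i \<omega>) \<partial>M)"
      using fact[OF i 2] by (simp add: J_def ennreal_mult' H0)
    finally show ?thesis .
  qed
  have tail: "prob {\<omega>\<in>space M. (\<Sum>i=1..n. J i \<omega>) < s} \<le> 2 / ((1 - ln 2) * (n * p))"
    unfolding s_def
  proof (rule prob_count_less_half_mean)
    have "(\<lambda>u::real \<times> 'b. of_bool (fst u > 0) :: real) \<in> borel \<rightarrow>\<^sub>M borel" unfolding borel_prod[symmetric] by measurable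
    from indep_vars_compose2[OF ind this]
    show "indep_vars (\<lambda>_. borel) J ?I" unfolding J_def by simp
    show "expectation (J i) = p" if "i \<in> ?I" for i
    proof -
      have "expectation (J i) = expectation (indicator {\<omega>\<in>space M. w i \<omega> > 0})"
        by (intro Bochner_Integration.integral_cong) (auto simp: J_def)
      then show ?thesis using prob_pos[OF that] that by simp
    qed
  qed (use n p in \<open>auto simp: J_def\<close>)
  \<comment> \<open>The products \<open>J i * H i\<close> sum to at most one indicator, so the
    \<open>n\<close> terms together cost a single tail probability rather than \<open>n\<close> of
    them.\<close>
  have sum_cross: "(\<Sum>i=1..n. \<integral>\<^sup>+\<omega>. ennreal (J i \<omega> * (norm (e i \<omega>))\<^sup>2 * H i \<omega>) \<partial>M) \<le>
    ennreal (v * (2 / ((1 - ln 2) * (n * p))))"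
  proof -
    have "(\<Sum>i=1..n. \<integral>\<^sup>+\<omega>. ennreal (J i \<omega> * (norm (e i \<omega>))\<^sup>2 * H i \<omega>) \<partial>M) \<le>
      (\<Sum>i=1..n. ennreal v * (\<integral>\<^sup>+\<omega>. ennreal (J i \<omega> * H i \<omega>) \<partial>M))"
      by (intro sum_mono cross)
    also have "\<dots> = ennreal v * (\<Sum>i=1..n. \<integral>\<^sup>+\<omega>. ennreal (J i \<omega> * H i \<omega>) \<partial>M)"
      by (simp only: sum_distrib_left)
    also have "(\<Sum>i=1..n. \<integral>\<^sup>+\<omega>. ennreal (J i \<omega> * H i \<omega>) \<partial>M) = (\<integral>\<^sup>+\<omega>. (\<Sum>i=1..n. ennreal (J i \<omega> * H i \<omega>)) \<partial>M)"
      by (intro nn_integral_sum[symmetric]) auto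
    also have "\<dots> \<le> (\<integral>\<^sup>+\<omega>. indicator {\<omega>\<in>space M. (\<Sum>i=1..n. J i \<omega>) < s} \<omega> \<partial>M)"
    proof (rule nn_integral_mono)
      fix \<omega> assume "\<omega> \<in> space M"
      have "(\<Sum>i=1..n. J i \<omega> * H i \<omega>) \<le> of_bool ((\<Sum>i=1..n. J i \<omega>) < s)"
        using self_normalized_split(2)[where I="?I" and w="\<lambda>i. w i \<omega>", OF _ k s w]
        unfolding H_def J_def by simp
      then have "ennreal (\<Sum>i=1..n. J i \<omega> * H i \<omega>) \<le> ennreal (of_bool ((\<Sum>i=1..n. J i \<omega>) < s))"
        by (rule ennreal_leI)
      then show "(\<Sum>i=1..n. ennreal (J i \<omega> * H i \<omega>)) \<le> indicator {\<omega>\<in>space M. (\<Sum>i=1..n. J i \<omega>) < s} \<omega>"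
        using \<open>\<omega> \<in> space M\<close> by (auto simp: J0 H0 ennreal_neg indicator_def split: if_splits)
    qed
    also have "\<dots> = ennreal (prob {\<omega>\<in>space M. (\<Sum>i=1..n. J i \<omega>) < s})"
    proof -
      have [measurable]: "(\<lambda>\<omega>. \<Sum>i=1..n. J i \<omega>) \<in> borel_measurable M"
        by (intro borel_measurable_sum Jm)
      have "{\<omega>\<in>space M. (\<Sum>i=1..n. J i \<omega>) < s} \<in> sets M" by measurable
      then show ?thesis by (simp add: emeasure_eq_measure)
    qed
    also have "\<dots> \<le> ennreal (2 / ((1 - ln 2) * (n * p)))" by (intro ennreal_leI tail)
    finally show ?thesis using v by (simp add: ennreal_mult' mult_left_mono del: times_divide_eq_right)
  qed

  have "(\<integral>\<^sup>+\<omega>. ennreal ((norm (?S \<omega> /\<^sub>R (\<Sum>i=1..n. w i \<omega>)))\<^sup>2) \<partial>M) \<le>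
    (\<integral>\<^sup>+\<omega>. ennreal ((1 / (k_lo * s))\<^sup>2) * ennreal ((norm (?S \<omega>))\<^sup>2) +
      ennreal (k_hi / k_lo) * (\<Sum>i=1..n. ennreal (J i \<omega> * (norm (e i \<omega>))\<^sup>2 * H i \<omega>)) \<partial>M)"
  proof (rule nn_integral_mono)
    fix \<omega> assume "\<omega> \<in> space M"
    have "(norm (?S \<omega> /\<^sub>R (\<Sum>i=1..n. w i \<omega>)))\<^sup>2 \<le>
      (1 / (k_lo * s))\<^sup>2 * (norm (?S \<omega>))\<^sup>2 + k_hi / k_lo * (\<Sum>i=1..n. J i \<omega> * (norm (e i \<omega>))\<^sup>2 * H i \<omega>)"
      using self_normalized_split(1)[where I="?I" and w="\<lambda>i. w i \<omega>", OF _ k s w]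
      unfolding H_def J_def W_def by simp
    then have "ennreal ((norm (?S \<omega> /\<^sub>R (\<Sum>i=1..n. w i \<omega>)))\<^sup>2) \<le>
      ennreal ((1 / (k_lo * s))\<^sup>2 * (norm (?S \<omega>))\<^sup>2 + k_hi / k_lo * (\<Sum>i=1..n. J i \<omega> * (norm (e i \<omega>))\<^sup>2 * H i \<omega>))"
      by (rule ennreal_leI)
    also have "\<dots> = ennreal ((1 / (k_lo * s))\<^sup>2) * ennreal ((norm (?S \<omega>))\<^sup>2) +
      ennreal (k_hi / k_lo) * (\<Sum>i=1..n. ennreal (J i \<omega> * (norm (e i \<omega>))\<^sup>2 * H i \<omega>))"
    proof -
      have "(\<Sum>i=1..n. ennreal (J i \<omega> * (norm (e i \<omega>))\<^sup>2 * H i \<omega>)) =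
        ennreal (\<Sum>i=1..n. J i \<omega> * (norm (e i \<omega>))\<^sup>2 * H i \<omega>)"
        by (intro sum_ennreal) (auto simp: J0 H0)
      moreover have "0 \<le> (\<Sum>i=1..n. J i \<omega> * (norm (e i \<omega>))\<^sup>2 * H i \<omega>)"
        by (intro sum_nonneg) (auto simp: J0 H0)
      moreover have "0 \<le> k_hi / k_lo" using k kh by simp
      ultimately show ?thesis
        by (simp only: ennreal_mult[symmetric] ennreal_plus[symmetric] zero_le_power2 mult_nonneg_nonneg)
    qed
    finally show "ennreal ((norm (?S \<omega> /\<^sub>R (\<Sum>i=1..n. w i \<omega>)))\<^sup>2) \<le> \<dots>" .
  qed
  also have "\<dots> = ennreal ((1 / (k_lo * s))\<^sup>2) * (\<integral>\<^sup>+\<omega>. ennreal ((norm (?S \<omega>))\<^sup>2) \<partial>M) +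
      ennreal (k_hi / k_lo) * (\<Sum>i=1..n. \<integral>\<^sup>+\<omega>. ennreal (J i \<omega> * (norm (e i \<omega>))\<^sup>2 * H i \<omega>) \<partial>M)"
  proof -
    have m: "(\<lambda>\<omega>. ennreal (J i \<omega> * (norm (e i \<omega>))\<^sup>2 * H i \<omega>)) \<in> borel_measurable M" if "i \<in> ?I" for i
      using that by measurable
    have "(\<integral>\<^sup>+\<omega>. (\<Sum>i=1..n. ennreal (J i \<omega> * (norm (e i \<omega>))\<^sup>2 * H i \<omega>)) \<partial>M) =
        (\<Sum>i=1..n. \<integral>\<^sup>+\<omega>. ennreal (J i \<omega> * (norm (e i \<omega>))\<^sup>2 * H i \<omega>) \<partial>M)"
      by (rule nn_integral_sum[OF m])
    moreover have [measurable]: "(\<lambda>\<omega>. \<Sum>i=1..n. ennreal (J i \<omega> * (norm (e i \<omega>))\<^sup>2 * H i \<omega>)) \<in> borel_measurable M"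
      by (intro borel_measurable_sum m)
    ultimately show ?thesis
      by (simp add: nn_integral_add nn_integral_cmult)
  qed
  also have "\<dots> \<le> ennreal ((1 / (k_lo * s))\<^sup>2) * ennreal (c * k_hi\<^sup>2 * v * (n * p)) +
      ennreal (k_hi / k_lo) * ennreal (v * (2 / ((1 - ln 2) * (n * p))))"
    by (intro add_mono mult_left_mono nnS sum_cross) auto
  also have "\<dots> = ennreal ((1 / (k_lo * s))\<^sup>2 * (c * k_hi\<^sup>2 * v * (n * p)) + k_hi / k_lo * (v * (2 / ((1 - ln 2) * (n * p)))))"
  proof -
    have "0 \<le> k_hi / k_lo" "0 \<le> c * k_hi\<^sup>2 * v * (n * p)" "0 \<le> v * (2 / ((1 - ln 2) * (n * p)))"
      using k kh v p c ln_2_less_1 by auto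
    then show ?thesis
      by (simp only: ennreal_mult[symmetric] ennreal_plus[symmetric] zero_le_power2 mult_nonneg_nonneg)
  qed
  also have "(1 / (k_lo * s))\<^sup>2 * (c * k_hi\<^sup>2 * v * (n * p)) + k_hi / k_lo * (v * (2 / ((1 - ln 2) * (n * p)))) =
    (4 * c * k_hi\<^sup>2 * v / k_lo\<^sup>2 + 2 * k_hi * v / (k_lo * (1 - ln 2))) / (n * p)"
    using n p k ln_2_less_1 by (simp add: s_def field_simps power2_eq_square)
  finally show ?thesis unfolding W_def .
qed

section \<open>The small ball exponent\<close>

context
  fixes C s t :: real
  assumes C: "C > 0" and st: "s \<ge> 0" "t \<ge> 0" "s > 0 \<or> t > 1"
begin

lemma small_ball_exponent_strict_antimono:
  assumes "0 < g" "g < h" "h < 1"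
  shows "small_ball_exponent C s t h < small_ball_exponent C s t g"
proof -
  have 1: "0 < 1 / h" "1 / h < 1 / g" "0 < ln (1 / h)" "ln (1 / h) < ln (1 / g)"
    using assms by (auto simp: divide_simps)
  have 2: "(1 / h) powr s \<le> (1 / g) powr s" "(ln (1 / h)) powr t \<le> (ln (1 / g)) powr t"
    using 1 st by (auto intro!: powr_mono2)
  have "(1 / h) powr s * (ln (1 / h)) powr t < (1 / g) powr s * (ln (1 / g)) powr t"
  proof (cases "s > 0")
    case True
    then have "(1 / h) powr s < (1 / g) powr s" using 1 by (intro powr_less_mono2) auto
    then show ?thesis using 1 2 assms by (intro mult_less_le_imp_less) auto
  next
    case False
    then have "(ln (1 / h)) powr t < (ln (1 / g)) powr t" using 1 st by (intro powr_less_mono2) auto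
    then show ?thesis using 1 2 assms by (intro mult_le_less_imp_less) auto
  qed
  then show ?thesis using C by (simp add: small_ball_exponent_def mult.assoc)
qed

lemma inj_on_small_ball_exponent: "inj_on (small_ball_exponent C s t) {0<..<1}"
proof (rule inj_onI)
  fix g h :: real
  assume gh: "g \<in> {0<..<1}" "h \<in> {0<..<1}" "small_ball_exponent C s t g = small_ball_exponent C s t h"
  then show "g = h"
    using small_ball_exponent_strict_antimono[of g h] small_ball_exponent_strict_antimono[of h g]
    by (cases g h rule: linorder_cases) auto
qed

lemma small_ball_exponent_at_top: "filterlim (small_ball_exponent C s t) at_top (at_right 0)"
proof (cases "s > 0")
  case True
  have 1: "filterlim (\<lambda>h::real. C * (1 / h) powr s) at_top (at_right 0)"
    using C True by real_asymp
  have "\<forall>\<^sub>F h in at_right (0::real). ln (1 / h) \<ge> 1" by real_asymp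
  then have "\<forall>\<^sub>F h in at_right (0::real). C * (1 / h) powr s \<le> small_ball_exponent C s t h"
  proof eventually_elim
    case (elim h)
    then have "1 \<le> (ln (1 / h)) powr t" using st by (intro ge_one_powr_ge_zero) auto
    then show ?case using C unfolding small_ball_exponent_def
      by (metis mult.right_neutral mult_left_mono mult_nonneg_nonneg powr_ge_zero less_imp_le)
  qed
  then show ?thesis by (rule filterlim_at_top_mono[OF 1])
next
  case False
  then have s: "s = 0" "t > 1" using st by auto
  have "filterlim (\<lambda>h::real. C * (ln (1 / h)) powr t) at_top (at_right 0)"
    using C s by real_asymp
  moreover have "\<forall>\<^sub>F h in at_right (0::real). C * (ln (1 / h)) powr t = small_ball_exponent C s t h"
    using eventually_at_right_less[of 0] by eventually_elim (simp add: small_ball_exponent_def s)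
  ultimately show ?thesis by (auto elim: filterlim_mono_eventually)
qed

text \<open>\<open>the_inv_into\<close> is meaningful only on the image of the exponent. Every value
  above \<open>u0\<close>, the exponent at \<open>1 / 2\<close>, is attained by the intermediate
  value theorem between \<open>1 / 2\<close> and a point close to 0; any other fixed point of the
  unit interval would serve. The limit comes from monotonicity: a value above the exponent at
  \<open>g\<close> is taken to the left of \<open>g\<close>.\<close>

lemma small_ball_exponent_inverse:
  obtains u0 where
    "\<And>u. u > u0 \<Longrightarrow> the_inv_into {0<..<1} (small_ball_exponent C s t) u \<in> {0<..<1}"
    "\<And>u. u > u0 \<Longrightarrow> small_ball_exponent C s t (the_inv_into {0<..<1} (small_ball_exponent C s t) u) = u"
    "filterlim (the_inv_into {0<..<1} (small_ball_exponent C s t)) (at_right 0) at_top"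
proof -
  let ?m = "small_ball_exponent C s t" and ?v = "the_inv_into {0<..<1} (small_ball_exponent C s t)"
  define u0 where "u0 = ?m (1 / 2)"
  have surj: "u \<in> ?m ` {0<..<1}" if u: "u > u0" for u
  proof -
    have "\<forall>\<^sub>F h in at_right 0. ?m h \<ge> u \<and> h < 1 / 2 \<and> h > 0"
      using small_ball_exponent_at_top unfolding filterlim_at_top
      by (intro eventually_conj) (auto simp: eventually_at_right_less eventually_at_right_field intro: exI[of _ "1/2"])
    then obtain g where g: "?m g \<ge> u" "g < 1 / 2" "g > 0"
      using eventually_happens'[OF trivial_limit_at_right_real] by blast
    have "continuous_on {g..1/2} ?m"
      using g unfolding small_ball_exponent_def by (intro continuous_intros) auto
    then obtain h where "g \<le> h" "h \<le> 1 / 2" "?m h = u"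
      using IVT2'[of ?m "1/2" u g] g u by (auto simp: u0_def)
    then show ?thesis using g by (intro image_eqI[of _ _ h]) auto
  qed
  have 1: "?v u \<in> {0<..<1}" if "u > u0" for u
    by (rule the_inv_into_into[OF inj_on_small_ball_exponent surj[OF that] subset_refl])
  have 2: "?m (?v u) = u" if "u > u0" for u
    by (rule f_the_inv_into_f[OF inj_on_small_ball_exponent surj[OF that]])
  have 3: "filterlim ?v (at_right 0) at_top"
    unfolding filterlim_def le_filter_def eventually_filtermap
  proof safe
    fix P assume "eventually P (at_right (0::real))"
    then obtain b where b: "b > 0" "\<And>y. 0 < y \<Longrightarrow> y < b \<Longrightarrow> P y"
      unfolding eventually_at_right_field by auto
    define g where "g = min (b / 2) (1 / 2)"
    have g: "0 < g" "g < 1" "g < b" using b by (auto simp: g_def)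
    have "P (?v u)" if u: "u > max u0 (?m g)" for u
    proof (rule b(2))
      have v: "?v u \<in> {0<..<1}" "?m (?v u) = u" using 1 2 u by auto
      then show "0 < ?v u" by simp
      have "?v u < g"
      proof (rule ccontr)
        assume "\<not> ?v u < g"
        then have "?m (?v u) \<le> ?m g"
          using small_ball_exponent_strict_antimono[of g "?v u"] g v by (cases "?v u = g") auto
        then show False using u v by auto
      qed
      then show "?v u < b" using g by simp
    qed
    then show "eventually (\<lambda>u. P (?v u)) at_top"
      using eventually_gt_at_top[of "max u0 (?m g)"] by (auto elim: eventually_mono)
  qed
  show thesis using that[OF 1 2 3] .
qed

text \<open>If \<open>s > 0\<close>, halving the exponent suffices, as a power of
  \<open>1 / h\<close> dominates \<open>q * ln (1 / h)\<close>. If \<open>s = 0\<close>, the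
  exponent is \<open>C * w powr t\<close> with \<open>w = ln (1 / h)\<close>, and passing to
  \<open>a * h\<close> shifts \<open>w\<close> by \<open>ln a\<close>. The gain is then of order
  \<open>w powr (t - 1)\<close>, which is at least of order \<open>w\<close> because
  \<open>t \<ge> 2\<close>.\<close>

lemma small_ball_exponent_gap:
  assumes t: "s > 0 \<or> t \<ge> 2" and q: "q \<ge> 0"
  obtains a where "a > 1"
    "\<forall>\<^sub>F h in at_right 0. small_ball_exponent C s t (a * h) + q * ln (1 / h) \<le> small_ball_exponent C s t h"
proof (cases "s > 0")
  case True
  \<comment> \<open>With \<open>a powr s = 2\<close> the power factor is halved exactly, and the
    logarithmic factor does not grow since \<open>a > 1\<close>.\<close>
  define a where "a = (2::real) powr (1 / s)"
  have a: "a > 1" "a powr s = 2" using True by (auto simp: a_def powr_powr)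
  have "\<forall>\<^sub>F h in at_right (0::real). q * ln (1 / h) \<le> C / 2 * (1 / h) powr s"
    using True C q by real_asymp
  \<comment> \<open>The margin keeps \<open>ln (1 / (a * h))\<close> at least 1, in the range where
    \<open>powr\<close> is monotone in its base.\<close>
  moreover have "\<forall>\<^sub>F h in at_right (0::real). ln (1 / h) \<ge> 1 + ln a" by real_asymp
  ultimately have "\<forall>\<^sub>F h in at_right 0.
      small_ball_exponent C s t (a * h) + q * ln (1 / h) \<le> small_ball_exponent C s t h"
    using eventually_at_right_less[of 0]
  proof eventually_elim
    case (elim h)
    have la: "ln a > 0" using a(1) by (rule ln_gt_zero)
    have l: "ln (1 / (a * h)) = ln (1 / h) - ln a" using a elim by (simp add: ln_div ln_mult)
    have ps: "(1 / (a * h)) powr s = (1 / h) powr s / 2"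
      using a elim by (simp add: powr_divide powr_mult)
    have "(ln (1 / (a * h))) powr t \<le> (ln (1 / h)) powr t"
      unfolding l using elim la st by (intro powr_mono2) auto
    then have "small_ball_exponent C s t (a * h) \<le> C * ((1 / h) powr s / 2) * (ln (1 / h)) powr t"
      unfolding small_ball_exponent_def ps using C by (intro mult_left_mono) auto
    also have "\<dots> = small_ball_exponent C s t h / 2" by (simp add: small_ball_exponent_def)
    finally have A: "small_ball_exponent C s t (a * h) \<le> small_ball_exponent C s t h / 2" .
    have "1 \<le> (ln (1 / h)) powr t" using elim la st by (intro ge_one_powr_ge_zero) auto
    then have "C / 2 * (1 / h) powr s * 1 \<le> C / 2 * (1 / h) powr s * (ln (1 / h)) powr t"
      using C by (intro mult_left_mono) auto
    then have "q * ln (1 / h) \<le> small_ball_exponent C s t h / 2"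
      using elim(1) by (simp add: small_ball_exponent_def)
    with A show ?case by simp
  qed
  with a(1) that show thesis by blast
next
  case False
  then have s: "s = 0" "t \<ge> 2" using t st by auto
  \<comment> \<open>\<open>C * ln a = q + C\<close> exceeds \<open>q\<close>; the summand 1 also
    gives \<open>a > 1\<close> when \<open>q = 0\<close>.\<close>
  define a where "a = exp (q / C + 1)"
  have a: "a > 1" "ln a = q / C + 1" using q C by (auto simp: a_def add_nonneg_pos)
  have "\<forall>\<^sub>F h in at_right (0::real). ln (1 / h) \<ge> 1 + ln a" by real_asymp
  then have "\<forall>\<^sub>F h in at_right 0.
      small_ball_exponent C s t (a * h) + q * ln (1 / h) \<le> small_ball_exponent C s t h"
    using eventually_at_right_less[of 0]
  proof eventually_elim
    case (elim h)
    define w where "w = ln (1 / h)"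
    have la: "ln a > 0" using a(1) by (rule ln_gt_zero)
    have w: "w \<ge> 1 + ln a" using elim by (simp add: w_def)
    have l: "ln (1 / (a * h)) = w - ln a" using a elim by (simp add: w_def ln_div ln_mult)
    \<comment> \<open>One factor \<open>w - ln a\<close> is kept and the remaining power
      \<open>t - 1\<close> is enlarged to that of \<open>w\<close>; this exhibits the gain
      \<open>ln a * w powr (t - 1)\<close> without differentiation.\<close>
    have "(w - ln a) powr t = (w - ln a) powr 1 * (w - ln a) powr (t - 1)"
      by (simp only: powr_add[symmetric]) simp
    also have "\<dots> \<le> (w - ln a) * w powr (t - 1)"
      using w la s by (auto intro!: mult_left_mono powr_mono2)
    also have "\<dots> = w powr t - ln a * w powr (t - 1)"
      using w la powr_add[of w 1 "t - 1"] by (simp add: algebra_simps)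
    finally have "(w - ln a) powr t + ln a * w powr (t - 1) \<le> w powr t" by simp
    moreover have "ln a * w \<le> ln a * w powr (t - 1)"
      using w la s powr_mono[of 1 "t - 1" w] by (intro mult_left_mono) auto
    ultimately have "C * ((w - ln a) powr t + ln a * w) \<le> C * w powr t"
      using C by (intro mult_left_mono) auto
    moreover have "q * w \<le> C * (ln a * w)"
      using C w la unfolding a(2) by (simp add: algebra_simps)
    ultimately have "C * (w - ln a) powr t + q * w \<le> C * w powr t" by (simp add: algebra_simps)
    then show ?case using elim a by (simp add: small_ball_exponent_def s l flip: w_def)
  qed
  with a(1) that show thesis by blast
qed

end

section \<open>Rates of convergence\<close>

text \<open>Chebyshev's inequality for \<open>Z\<close>, combined with the triangle inequality. The
  moment hypothesis is a nonnegative integral, so that it contains square integrability.\<close>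

lemma (in prob_space)
  fixes Z R :: "nat \<Rightarrow> 'a \<Rightarrow> 'b::{real_normed_vector, second_countable_topology}"
  assumes Z[measurable]: "\<And>n. Z n \<in> borel_measurable M" and R[measurable]: "\<And>n. R n \<in> borel_measurable M"
    and A: "A \<ge> 0" and E: "E > 0" and d: "\<And>n. d n \<ge> 0"
    and r: "\<forall>\<^sub>F n in sequentially. r n > 0" and dr: "\<forall>\<^sub>F n in sequentially. d n \<le> E * r n"
    and Z2: "\<forall>\<^sub>F n in sequentially. (\<integral>\<^sup>+\<omega>. ennreal ((norm (Z n \<omega>))\<^sup>2) \<partial>M) \<le> ennreal (A * (r n)\<^sup>2)"
  shows bigO_in_prob_sum:
      "smallo_in_prob M R d \<Longrightarrow> bigO_in_prob M (\<lambda>n \<omega>. Z n \<omega> + R n \<omega>) r"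
    and mean_square_bigO_sum:
      "mean_square_smallo M R (\<lambda>n. (d n)\<^sup>2) \<Longrightarrow> mean_square_bigO M (\<lambda>n \<omega>. Z n \<omega> + R n \<omega>) (\<lambda>n. (r n)\<^sup>2)"
proof -
  have Z2': "\<forall>\<^sub>F n in sequentially. integrable M (\<lambda>\<omega>. (norm (Z n \<omega>))\<^sup>2) \<and>
      expectation (\<lambda>\<omega>. (norm (Z n \<omega>))\<^sup>2) \<le> A * (r n)\<^sup>2"
    using Z2
  proof eventually_elim
    case (elim n)
    have int: "integrable M (\<lambda>\<omega>. (norm (Z n \<omega>))\<^sup>2)"
      using le_less_trans[OF elim ennreal_less_top] by (intro integrableI_bounded) auto
    have "ennreal (expectation (\<lambda>\<omega>. (norm (Z n \<omega>))\<^sup>2)) \<le> ennreal (A * (r n)\<^sup>2)"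
      using elim by (subst nn_integral_eq_integral[OF int, symmetric]) auto
    then show ?case using A int by (subst (asm) ennreal_le_iff) auto
  qed
  show "bigO_in_prob M (\<lambda>n \<omega>. Z n \<omega> + R n \<omega>) r" if so: "smallo_in_prob M R d"
    unfolding bigO_in_prob_def
  proof (intro allI impI)
    fix \<epsilon> :: real assume \<epsilon>: "\<epsilon> > 0"
    \<comment> \<open>Chebyshev leaves \<open>A / C\<^sup>2\<close>, which is below
      \<open>\<epsilon> / 2\<close>; using \<open>A + 1\<close> keeps \<open>C\<close> positive when
      \<open>A = 0\<close>.\<close>
    define C where "C = sqrt (2 * (A + 1) / \<epsilon>)"
    have C: "C > 0" "C\<^sup>2 = 2 * (A + 1) / \<epsilon>" using A \<epsilon> by (auto simp: C_def)
    \<comment> \<open>At level 1 the remainder is at most \<open>d n\<close>, hence at most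
      \<open>E * r n\<close>, off an event of small probability; this explains the threshold
      \<open>C + E\<close>.\<close>
    have "(\<lambda>n. prob {\<omega>\<in>space M. norm (R n \<omega>) > 1 * d n}) \<longlonglongrightarrow> 0"
      using so[unfolded smallo_in_prob_def, rule_format, OF zero_less_one] .
    then have "\<forall>\<^sub>F n in sequentially. prob {\<omega>\<in>space M. norm (R n \<omega>) > 1 * d n} < \<epsilon> / 2"
      by (rule order_tendstoD(2)) (use \<epsilon> in simp)
    then have "\<forall>\<^sub>F n in sequentially. prob {\<omega>\<in>space M. norm (Z n \<omega> + R n \<omega>) > (C + E) * r n} \<le> \<epsilon>"
      using Z2' r dr
    proof eventually_elim
      case (elim n)
      have Cr: "C * r n > 0" using C elim by simp
      have "prob {\<omega>\<in>space M. norm (Z n \<omega> + R n \<omega>) > (C + E) * r n} \<le>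
        prob ({\<omega>\<in>space M. (norm (Z n \<omega>))\<^sup>2 \<ge> (C * r n)\<^sup>2} \<union> {\<omega>\<in>space M. norm (R n \<omega>) > 1 * d n})"
      proof (rule finite_measure_mono)
        show "{\<omega>\<in>space M. norm (Z n \<omega> + R n \<omega>) > (C + E) * r n} \<subseteq>
          {\<omega>\<in>space M. (norm (Z n \<omega>))\<^sup>2 \<ge> (C * r n)\<^sup>2} \<union> {\<omega>\<in>space M. norm (R n \<omega>) > 1 * d n}"
        proof safe
          fix \<omega> assume *: "norm (Z n \<omega> + R n \<omega>) > (C + E) * r n" "\<not> norm (R n \<omega>) > 1 * d n"
          then have "norm (Z n \<omega>) \<ge> C * r n"
            using norm_triangle_ineq[of "Z n \<omega>" "R n \<omega>"] elim by (simp add: algebra_simps)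
          then show "(norm (Z n \<omega>))\<^sup>2 \<ge> (C * r n)\<^sup>2" using Cr by (intro power_mono) auto
        qed
      qed measurable
      also have "\<dots> \<le> prob {\<omega>\<in>space M. (norm (Z n \<omega>))\<^sup>2 \<ge> (C * r n)\<^sup>2} + prob {\<omega>\<in>space M. norm (R n \<omega>) > 1 * d n}"
        by (intro measure_Un_le) measurable
      also have "prob {\<omega>\<in>space M. (norm (Z n \<omega>))\<^sup>2 \<ge> (C * r n)\<^sup>2} \<le> expectation (\<lambda>\<omega>. (norm (Z n \<omega>))\<^sup>2) / (C * r n)\<^sup>2"
        using elim Cr by (intro integral_Markov_inequality_measure[where A="space M"]) auto
      also have "\<dots> \<le> A * (r n)\<^sup>2 / (C * r n)\<^sup>2"
        using elim by (intro divide_right_mono) auto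
      also have "\<dots> = A / C\<^sup>2" using elim by (simp add: power_mult_distrib)
      also have "\<dots> \<le> \<epsilon> / 2"
        unfolding C(2) using \<epsilon> A by (simp add: field_simps)
      finally show ?case using elim by simp
    qed
    then show "\<exists>C>0. \<forall>\<^sub>F n in sequentially. prob {\<omega>\<in>space M. norm (Z n \<omega> + R n \<omega>) > C * r n} \<le> \<epsilon>"
      using C E by (intro exI[of _ "C + E"]) auto
  qed
  show "mean_square_bigO M (\<lambda>n \<omega>. Z n \<omega> + R n \<omega>) (\<lambda>n. (r n)\<^sup>2)"
    if so: "mean_square_smallo M R (\<lambda>n. (d n)\<^sup>2)"
  proof -
    have "\<forall>\<^sub>F n in sequentially. norm (expectation (\<lambda>\<omega>. (norm (R n \<omega>))\<^sup>2)) \<le> 1 * norm ((d n)\<^sup>2)"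
      using so unfolding mean_square_smallo_def by (intro landau_o.smallD) auto
    moreover have "\<forall>\<^sub>F n in sequentially. integrable M (\<lambda>\<omega>. (norm (R n \<omega>))\<^sup>2)"
      using so by (simp add: mean_square_smallo_def)
    ultimately have *: "\<forall>\<^sub>F n in sequentially. integrable M (\<lambda>\<omega>. (norm (Z n \<omega> + R n \<omega>))\<^sup>2) \<and>
      expectation (\<lambda>\<omega>. (norm (Z n \<omega> + R n \<omega>))\<^sup>2) \<le> (2 * A + 2 * E\<^sup>2) * (r n)\<^sup>2"
      using Z2' r dr
    proof eventually_elim
      case (elim n)
      have le: "(norm (Z n \<omega> + R n \<omega>))\<^sup>2 \<le> 2 * (norm (Z n \<omega>))\<^sup>2 + 2 * (norm (R n \<omega>))\<^sup>2" for \<omega>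
      proof -
        have "(norm (Z n \<omega> + R n \<omega>))\<^sup>2 \<le> (norm (Z n \<omega>) + norm (R n \<omega>))\<^sup>2"
          by (intro power_mono norm_triangle_ineq) auto
        also have "\<dots> \<le> 2 * (norm (Z n \<omega>))\<^sup>2 + 2 * (norm (R n \<omega>))\<^sup>2"
          using sum_squares_bound[of "norm (Z n \<omega>)" "norm (R n \<omega>)"] by (simp add: power2_sum)
        finally show ?thesis .
      qed
      have int: "integrable M (\<lambda>\<omega>. 2 * (norm (Z n \<omega>))\<^sup>2 + 2 * (norm (R n \<omega>))\<^sup>2)"
        using elim by auto
      have int': "integrable M (\<lambda>\<omega>. (norm (Z n \<omega> + R n \<omega>))\<^sup>2)"
        by (rule Bochner_Integration.integrable_bound[OF int]) (use le in auto)
      have "expectation (\<lambda>\<omega>. (norm (Z n \<omega> + R n \<omega>))\<^sup>2) \<le> expectation (\<lambda>\<omega>. 2 * (norm (Z n \<omega>))\<^sup>2 + 2 * (norm (R n \<omega>))\<^sup>2)"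
        by (intro integral_mono int int' le)
      also have "\<dots> = 2 * expectation (\<lambda>\<omega>. (norm (Z n \<omega>))\<^sup>2) + 2 * expectation (\<lambda>\<omega>. (norm (R n \<omega>))\<^sup>2)"
        using elim by simp
      also have "\<dots> \<le> 2 * (A * (r n)\<^sup>2) + 2 * (d n)\<^sup>2"
        using elim by (intro add_mono mult_left_mono) (auto simp: integral_nonneg)
      also have "(d n)\<^sup>2 \<le> (E * r n)\<^sup>2" using elim d by (intro power_mono) auto
      finally show ?case using int' by (simp add: power_mult_distrib algebra_simps)
    qed
    have "(\<lambda>n. expectation (\<lambda>\<omega>. (norm (Z n \<omega> + R n \<omega>))\<^sup>2)) \<in> O(\<lambda>n. (r n)\<^sup>2)"
      using * by (intro bigoI[where c="2 * A + 2 * E\<^sup>2"]) (auto elim!: eventually_mono simp: integral_nonneg)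
    with * show ?thesis unfolding mean_square_bigO_def by (auto elim: eventually_mono)
  qed
qed

section \<open>Second moments of the bias and variance terms at a fixed bandwidth\<close>

context
  fixes M :: "'w measure" and N :: "'r measure"
    and X :: "'w \<Rightarrow> 'c::polish_space" and Y :: "'w \<Rightarrow> 'r"
    and Xs :: "nat \<Rightarrow> 'w \<Rightarrow> 'c" and Ys :: "nat \<Rightarrow> 'w \<Rightarrow> 'r"
    and \<kappa> :: "'c \<Rightarrow> 'r measure" and x :: 'c and K :: "real \<Rightarrow> real"
    and F :: "'c \<Rightarrow> 'g::{banach, second_countable_topology}" and G :: "'r \<Rightarrow> 'g"
    and L :: "'g \<Rightarrow> 'b::{banach, second_countable_topology}"
    and k_lo k_hi h :: real
  assumes M: "prob_space M"
    and XY: "(\<lambda>\<omega>. (X \<omega>, Y \<omega>)) \<in> M \<rightarrow>\<^sub>M borel \<Otimes>\<^sub>M N"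
    and indep: "prob_space.indep_vars M (\<lambda>_. borel \<Otimes>\<^sub>M N) (\<lambda>i \<omega>. (Xs i \<omega>, Ys i \<omega>)) {1..}"
    and ident: "\<And>i. i \<ge> 1 \<Longrightarrow> distr M (borel \<Otimes>\<^sub>M N) (\<lambda>\<omega>. (Xs i \<omega>, Ys i \<omega>))
                  = distr M (borel \<Otimes>\<^sub>M N) (\<lambda>\<omega>. (X \<omega>, Y \<omega>))"
    and cond: "regular_cond_distr M borel X N Y \<kappa>"
    and F_meas[measurable]: "F \<in> borel_measurable borel" and G_meas[measurable]: "G \<in> borel_measurable N"
    and L: "bounded_linear L"
    and K_meas: "K \<in> borel_measurable (restrict_space borel {0..})"
    and K_const: "0 < k_lo" "k_lo \<le> k_hi"
    and K_on: "\<And>u. 0 \<le> u \<Longrightarrow> u \<le> 1 \<Longrightarrow> k_lo \<le> K u \<and> K u \<le> k_hi"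
    and K_off: "\<And>u. u > 1 \<Longrightarrow> K u = 0"
    and h: "h > 0"
begin

interpretation prob_space M by (rule M)

lemma L_measurable[measurable]: "L \<in> borel_measurable borel"
  by (intro borel_measurable_continuous_onI linear_continuous_on L)

lemma X_measurable[measurable]: "X \<in> borel_measurable M"
  using measurable_compose[OF XY measurable_fst] by simp

lemma sample_measurable: "i \<ge> 1 \<Longrightarrow> (\<lambda>\<omega>. (Xs i \<omega>, Ys i \<omega>)) \<in> M \<rightarrow>\<^sub>M borel \<Otimes>\<^sub>M N"
  using indep by (auto simp: indep_vars_def)

lemma Xs_measurable[measurable]: "i \<ge> 1 \<Longrightarrow> Xs i \<in> borel_measurable M"
  using measurable_compose[OF sample_measurable measurable_fst] by simp

text \<open>\<open>K\<close> is given as measurable on the half-line, so the scaled distance is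
  first regarded as a map into the restricted space.\<close>

lemma kernel_measurable[measurable]: "(\<lambda>z. K (dist x z / h)) \<in> borel_measurable borel"
proof -
  have "(\<lambda>z. dist x z / h) \<in> borel \<rightarrow>\<^sub>M restrict_space borel {0..}"
    using h by (intro measurable_restrict_space2) auto
  from measurable_compose[OF this K_meas] show ?thesis .
qed

lemma kernel_cases:
  "(dist x z \<le> h \<and> k_lo \<le> K (dist x z / h) \<and> K (dist x z / h) \<le> k_hi) \<or>
   (\<not> dist x z \<le> h \<and> K (dist x z / h) = 0)"
  using K_on[of "dist x z / h"] K_off[of "dist x z / h"] h
  by (cases "dist x z \<le> h") (auto simp: divide_simps)

lemma kernel_pos_iff: "0 < K (dist x z / h) \<longleftrightarrow> dist x z \<le> h"
  using kernel_cases[of z] K_const by auto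

lemma cond_mean_measurable[measurable]: "(\<lambda>z. \<integral>y. G y \<partial>\<kappa> z) \<in> borel_measurable borel"
proof -
  have "\<kappa> \<in> borel \<rightarrow>\<^sub>M subprob_algebra N"
    using cond by (auto simp: regular_cond_distr_def measurable_prob_algebraD)
  from measurable_compose[OF this integral_measurable_subprob_algebra[OF G_meas]] show ?thesis .
qed

lemma noise_measurable[measurable]:
  "(\<lambda>p. L (G (snd p) - (\<integral>y. G y \<partial>\<kappa> (fst p)))) \<in> borel_measurable (borel \<Otimes>\<^sub>M N)"
  by measurable

lemma weight_measurable[measurable]:
  "i \<ge> 1 \<Longrightarrow> (\<lambda>\<omega>. kernel_weight K x Xs h \<omega> i) \<in> borel_measurable M"
  unfolding kernel_weight_def by (rule measurable_compose[OF Xs_measurable kernel_measurable])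

lemma bias_term_measurable: "bias_term L F K x Xs h n \<in> borel_measurable M"
proof -
  have [measurable]: "(\<lambda>\<omega>. \<Sum>i=1..n. kernel_weight K x Xs h \<omega> i) \<in> borel_measurable M"
    by (intro borel_measurable_sum weight_measurable) auto
  have [measurable]: "(\<lambda>\<omega>. \<Sum>i=1..n. kernel_weight K x Xs h \<omega> i *\<^sub>R F (Xs i \<omega>)) \<in> borel_measurable M"
    by (intro borel_measurable_sum borel_measurable_scaleR weight_measurable
      measurable_compose[OF Xs_measurable F_meas]) auto
  show ?thesis unfolding bias_term_def by measurable
qed

text \<open>Type 2 is assumed of \<open>'b\<close>, not of \<open>'g\<close>; moving
  \<open>L\<close> inside presents the variance term as a self-normalized sum in
  \<open>'b\<close>.\<close>

lemma variance_term_eq: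
  "variance_term L G \<kappa> K x Xs Ys h n \<omega> =
    (\<Sum>i=1..n. kernel_weight K x Xs h \<omega> i *\<^sub>R L (G (Ys i \<omega>) - (\<integral>y. G y \<partial>\<kappa> (Xs i \<omega>))))
      /\<^sub>R (\<Sum>i=1..n. kernel_weight K x Xs h \<omega> i)"
proof -
  interpret bounded_linear L by (rule L)
  show ?thesis by (simp add: variance_term_def scaleR sum)
qed

lemma variance_term_measurable: "variance_term L G \<kappa> K x Xs Ys h n \<in> borel_measurable M"
proof -
  have [measurable]: "(\<lambda>\<omega>. \<Sum>i=1..n. kernel_weight K x Xs h \<omega> i) \<in> borel_measurable M"
    by (intro borel_measurable_sum weight_measurable) auto
  have "(\<lambda>\<omega>. L (G (Ys i \<omega>) - (\<integral>y. G y \<partial>\<kappa> (Xs i \<omega>)))) \<in> borel_measurable M" if "i \<ge> 1" for i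
    using measurable_compose[OF sample_measurable[OF that] noise_measurable] by simp
  then have [measurable]: "(\<lambda>\<omega>. \<Sum>i=1..n. kernel_weight K x Xs h \<omega> i *\<^sub>R
      L (G (Ys i \<omega>) - (\<integral>y. G y \<partial>\<kappa> (Xs i \<omega>)))) \<in> borel_measurable M"
    by (intro borel_measurable_sum borel_measurable_scaleR weight_measurable) auto
  show ?thesis unfolding variance_term_eq[abs_def] by measurable
qed

lemma prob_weight_pos:
  assumes i: "i \<ge> 1"
  shows "prob {\<omega>\<in>space M. kernel_weight K x Xs h \<omega> i > 0} = small_ball_prob M X x h"
proof -
  let ?B = "{p \<in> space (borel \<Otimes>\<^sub>M N). dist x (fst p) \<le> h}"
  have B: "?B \<in> sets (borel \<Otimes>\<^sub>M N)" by measurable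
  have "prob {\<omega>\<in>space M. kernel_weight K x Xs h \<omega> i > 0}
      = measure (distr M (borel \<Otimes>\<^sub>M N) (\<lambda>\<omega>. (Xs i \<omega>, Ys i \<omega>))) ?B"
    using measurable_space[OF sample_measurable[OF i]]
    by (subst measure_distr[OF sample_measurable[OF i] B])
      (auto intro!: arg_cong[where f=prob] simp: kernel_weight_def kernel_pos_iff)
  also have "\<dots> = small_ball_prob M X x h"
    using measurable_space[OF XY] unfolding ident[OF i] small_ball_prob_def
    by (subst measure_distr[OF XY B]) (auto intro!: arg_cong[where f=prob])
  finally show ?thesis .
qed

lemma indep_sample: "indep_vars (\<lambda>_. borel \<Otimes>\<^sub>M N) (\<lambda>i \<omega>. (Xs i \<omega>, Ys i \<omega>)) {1..n}"
  by (rule indep_vars_subset[OF indep]) auto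

text \<open>If all weights vanish, the count of points in the ball is 0 and so below half its mean;
  the bound for small counts applies. The event matters because the quotient in the bias is then
  read as 0.\<close>

lemma prob_no_weight:
  assumes n: "n \<ge> 1" and p: "small_ball_prob M X x h > 0"
  shows "prob {\<omega>\<in>space M. (\<Sum>i=1..n. kernel_weight K x Xs h \<omega> i) = 0}
    \<le> 2 / ((1 - ln 2) * (n * small_ball_prob M X x h))"
proof -
  define J where "J i \<omega> = (of_bool (kernel_weight K x Xs h \<omega> i > 0) :: real)" for i \<omega>
  have Jm[measurable]: "J i \<in> borel_measurable M" if "i \<in> {1..n}" for i
  proof -
    have [measurable]: "(\<lambda>\<omega>. kernel_weight K x Xs h \<omega> i) \<in> borel_measurable M" using that by auto
    show ?thesis unfolding J_def by measurable
  qed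
  have "prob {\<omega>\<in>space M. (\<Sum>i=1..n. kernel_weight K x Xs h \<omega> i) = 0} \<le>
    prob {\<omega>\<in>space M. (\<Sum>i=1..n. J i \<omega>) < n * small_ball_prob M X x h / 2}"
  proof (rule finite_measure_mono)
    show "{\<omega>\<in>space M. (\<Sum>i=1..n. J i \<omega>) < n * small_ball_prob M X x h / 2} \<in> events"
    proof -
      have [measurable]: "(\<lambda>\<omega>. \<Sum>i=1..n. J i \<omega>) \<in> borel_measurable M"
        by (intro borel_measurable_sum Jm)
      show ?thesis by measurable
    qed
    show "{\<omega>\<in>space M. (\<Sum>i=1..n. kernel_weight K x Xs h \<omega> i) = 0} \<subseteq>
      {\<omega>\<in>space M. (\<Sum>i=1..n. J i \<omega>) < n * small_ball_prob M X x h / 2}"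
    proof safe
      fix \<omega> assume "(\<Sum>i=1..n. kernel_weight K x Xs h \<omega> i) = 0"
      moreover have "kernel_weight K x Xs h \<omega> i \<ge> 0" for i
        using kernel_cases[of "Xs i \<omega>"] K_const by (auto simp: kernel_weight_def)
      ultimately have "kernel_weight K x Xs h \<omega> i = 0" if "i \<in> {1..n}" for i
        using that by (subst (asm) sum_nonneg_eq_0_iff) auto
      then have "(\<Sum>i=1..n. J i \<omega>) = 0" by (intro sum.neutral) (auto simp: J_def)
      then show "(\<Sum>i=1..n. J i \<omega>) < n * small_ball_prob M X x h / 2" using n p by simp
    qed
  qed
  also have "\<dots> \<le> 2 / ((1 - ln 2) * (n * small_ball_prob M X x h))"
  proof (rule prob_count_less_half_mean)
    have "(\<lambda>p. of_bool (K (dist x (fst p) / h) > 0) :: real) \<in> borel \<Otimes>\<^sub>M N \<rightarrow>\<^sub>M borel"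
      by measurable
    from indep_vars_compose2[OF indep_sample this]
    show "indep_vars (\<lambda>_. borel) J {1..n}" unfolding J_def kernel_weight_def by simp
    show "expectation (J i) = small_ball_prob M X x h" if "i \<in> {1..n}" for i
    proof -
      have [measurable]: "(\<lambda>\<omega>. kernel_weight K x Xs h \<omega> i) \<in> borel_measurable M" using that by auto
      have "expectation (J i) = expectation (indicator {\<omega>\<in>space M. kernel_weight K x Xs h \<omega> i > 0})"
        by (intro Bochner_Integration.integral_cong) (auto simp: J_def)
      also have "\<dots> = prob {\<omega>\<in>space M. kernel_weight K x Xs h \<omega> i > 0}" by simp
      finally show ?thesis using prob_weight_pos[of i] that by simp
    qed
  qed (use n p in \<open>auto simp: J_def\<close>)
  finally show ?thesis .
qed

text \<open>With positive total weight, convexity bounds the centred mean by \<open>B\<close>, since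
  only points of the ball carry weight. With total weight 0 the bias is \<open>- L (F x)\<close>, a
  fixed vector that enters with the probability of an empty ball.\<close>

lemma bias_second_moment:
  assumes n: "n \<ge> 1" and p: "small_ball_prob M X x h > 0"
    and F_local: "\<And>z. dist x z \<le> h \<Longrightarrow> norm (F z - F x) \<le> B"
    and l: "\<And>v. norm (L v) \<le> norm v * l"
  shows "(\<integral>\<^sup>+\<omega>. ennreal ((norm (bias_term L F K x Xs h n \<omega>))\<^sup>2) \<partial>M) \<le>
    ennreal ((B * l)\<^sup>2 + (norm (L (F x)))\<^sup>2 * (2 / ((1 - ln 2) * (n * small_ball_prob M X x h))))"
proof -
  define D where "D \<omega> = (\<Sum>i=1..n. kernel_weight K x Xs h \<omega> i)" for \<omega>
  have [measurable]: "D \<in> borel_measurable M"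
    unfolding D_def by (intro borel_measurable_sum weight_measurable) auto
  have pw: "(norm (bias_term L F K x Xs h n \<omega>))\<^sup>2 \<le> (B * l)\<^sup>2 + (norm (L (F x)))\<^sup>2 * of_bool (D \<omega> = 0)" for \<omega>
  proof (cases "D \<omega> = 0")
    case True
    interpret bounded_linear L by (rule L)
    have "bias_term L F K x Xs h n \<omega> = - L (F x)"
      using True by (simp add: bias_term_def D_def diff zero neg)
    then show ?thesis using True by simp
  next
    case False
    let ?w = "kernel_weight K x Xs h \<omega>"
    have w0: "?w i \<ge> 0" for i
      using kernel_cases[of "Xs i \<omega>"] K_const by (auto simp: kernel_weight_def)
    have "F x = (\<Sum>i=1..n. ?w i *\<^sub>R F x) /\<^sub>R D \<omega>"
      using False by (simp add: D_def flip: scaleR_sum_left)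
    then have "(\<Sum>i=1..n. ?w i *\<^sub>R F (Xs i \<omega>)) /\<^sub>R D \<omega> - F x =
        (\<Sum>i=1..n. ?w i *\<^sub>R F (Xs i \<omega>)) /\<^sub>R D \<omega> - (\<Sum>i=1..n. ?w i *\<^sub>R F x) /\<^sub>R D \<omega>" by simp
    also have "\<dots> = (\<Sum>i=1..n. ?w i *\<^sub>R (F (Xs i \<omega>) - F x)) /\<^sub>R D \<omega>"
      by (simp add: scaleR_diff_right sum_subtractf)
    finally have eq: "(\<Sum>i=1..n. ?w i *\<^sub>R F (Xs i \<omega>)) /\<^sub>R D \<omega> - F x =
        (\<Sum>i=1..n. ?w i *\<^sub>R (F (Xs i \<omega>) - F x)) /\<^sub>R D \<omega>" .
    have "(norm ((\<Sum>i=1..n. ?w i *\<^sub>R F (Xs i \<omega>)) /\<^sub>R D \<omega> - F x))\<^sup>2 \<le>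
        (\<Sum>i=1..n. ?w i / D \<omega> * (norm (F (Xs i \<omega>) - F x))\<^sup>2)"
      unfolding eq unfolding D_def using w0 by (intro norm_weighted_mean_power2_le)
    also have "\<dots> \<le> (\<Sum>i=1..n. ?w i / D \<omega> * B\<^sup>2)"
    proof (rule sum_mono)
      fix i
      have "D \<omega> \<ge> 0" unfolding D_def using w0 by (intro sum_nonneg)
      moreover have "(norm (F (Xs i \<omega>) - F x))\<^sup>2 \<le> B\<^sup>2" if "?w i \<noteq> 0"
        using that kernel_cases[of "Xs i \<omega>"]
        by (intro power_mono F_local) (auto simp: kernel_weight_def)
      ultimately show "?w i / D \<omega> * (norm (F (Xs i \<omega>) - F x))\<^sup>2 \<le> ?w i / D \<omega> * B\<^sup>2"
        using w0[of i] by (cases "?w i = 0") (simp, intro mult_left_mono divide_nonneg_nonneg, simp_all)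
    qed
    also have "\<dots> = B\<^sup>2"
      using False by (simp add: D_def flip: sum_distrib_right sum_divide_distrib)
    finally have *: "(norm ((\<Sum>i=1..n. ?w i *\<^sub>R F (Xs i \<omega>)) /\<^sub>R D \<omega> - F x))\<^sup>2 \<le> B\<^sup>2" .
    have "(norm (bias_term L F K x Xs h n \<omega>))\<^sup>2 \<le> (norm ((\<Sum>i=1..n. ?w i *\<^sub>R F (Xs i \<omega>)) /\<^sub>R D \<omega> - F x) * l)\<^sup>2"
      unfolding bias_term_def D_def by (intro power_mono l) auto
    also have "\<dots> \<le> (B * l)\<^sup>2"
      using * by (simp add: power_mult_distrib mult_right_mono)
    finally show ?thesis using False by simp
  qed
  have "(\<integral>\<^sup>+\<omega>. ennreal ((norm (bias_term L F K x Xs h n \<omega>))\<^sup>2) \<partial>M) \<le>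
    (\<integral>\<^sup>+\<omega>. ennreal ((B * l)\<^sup>2) + ennreal ((norm (L (F x)))\<^sup>2) * indicator {\<omega>\<in>space M. D \<omega> = 0} \<omega> \<partial>M)"
  proof (rule nn_integral_mono)
    fix \<omega> assume \<omega>: "\<omega> \<in> space M"
    have "ennreal ((norm (bias_term L F K x Xs h n \<omega>))\<^sup>2) \<le>
        ennreal ((B * l)\<^sup>2 + (norm (L (F x)))\<^sup>2 * of_bool (D \<omega> = 0))"
      by (rule ennreal_leI[OF pw])
    also have "\<dots> = ennreal ((B * l)\<^sup>2) + ennreal ((norm (L (F x)))\<^sup>2) * indicator {\<omega>\<in>space M. D \<omega> = 0} \<omega>"
      using \<omega> by (cases "D \<omega> = 0") auto
    finally show "ennreal ((norm (bias_term L F K x Xs h n \<omega>))\<^sup>2) \<le> \<dots>" .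
  qed
  also have "\<dots> = ennreal ((B * l)\<^sup>2) + ennreal ((norm (L (F x)))\<^sup>2) * emeasure M {\<omega>\<in>space M. D \<omega> = 0}"
    by (simp add: nn_integral_add nn_integral_cmult emeasure_space_1)
  also have "\<dots> = ennreal ((B * l)\<^sup>2 + (norm (L (F x)))\<^sup>2 * prob {\<omega>\<in>space M. D \<omega> = 0})"
    by (simp add: emeasure_eq_measure ennreal_mult)
  also have "\<dots> \<le> ennreal ((B * l)\<^sup>2 + (norm (L (F x)))\<^sup>2 * (2 / ((1 - ln 2) * (n * small_ball_prob M X x h))))"
    unfolding D_def by (intro ennreal_leI add_left_mono mult_left_mono prob_no_weight n p) auto
  finally show ?thesis .
qed

text \<open>The self-normalized bound is applied with \<open>v = l\<^sup>2 * b\<close>. Integrating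
  first over \<open>\<kappa> z\<close> supplies its inputs: the noise has second moment at most
  \<open>l\<^sup>2 * b\<close> times the ball probability on the ball, and the weighted noise has
  mean 0.\<close>

lemma variance_second_moment:
  assumes n: "n \<ge> 1" and p: "small_ball_prob M X x h > 0" and b: "b \<ge> 0"
    and G_local: "\<And>z. dist x z \<le> h \<Longrightarrow> integrable (\<kappa> z) G \<and>
      (\<integral>\<^sup>+y. ennreal ((norm (G y - (\<integral>y'. G y' \<partial>\<kappa> z)))\<^sup>2) \<partial>\<kappa> z) \<le> ennreal b"
    and l: "\<And>v. norm (L v) \<le> norm v * l"
    and type2: "\<And>W :: nat \<Rightarrow> 'w \<Rightarrow> 'b. indep_vars (\<lambda>_. borel) W {1..n} \<Longrightarrow>
      (\<And>i. i \<in> {1..n} \<Longrightarrow> integrable M (W i) \<and> integral\<^sup>L M (W i) = 0 \<and>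
        integrable M (\<lambda>\<omega>. (norm (W i \<omega>))\<^sup>2)) \<Longrightarrow>
      (\<integral>\<omega>. (norm (\<Sum>i=1..n. W i \<omega>))\<^sup>2 \<partial>M) \<le> c * (\<Sum>i=1..n. \<integral>\<omega>. (norm (W i \<omega>))\<^sup>2 \<partial>M)"
    and c: "c > 0"
  shows "(\<integral>\<^sup>+\<omega>. ennreal ((norm (variance_term L G \<kappa> K x Xs Ys h n \<omega>))\<^sup>2) \<partial>M) \<le>
    ennreal ((4 * c * k_hi\<^sup>2 * (l\<^sup>2 * b) / k_lo\<^sup>2 + 2 * k_hi * (l\<^sup>2 * b) / (k_lo * (1 - ln 2)))
      / (n * small_ball_prob M X x h))"
proof -
  let ?p = "small_ball_prob M X x h"
  let ?\<rho> = "distr M (borel \<Otimes>\<^sub>M N) (\<lambda>\<omega>. (X \<omega>, Y \<omega>))"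
  define g where "g z = (\<integral>y. G y \<partial>\<kappa> z)" for z
  define f where "f p = K (dist x (fst p) / h) *\<^sub>R L (G (snd p) - g (fst p))" for p
  have [measurable]: "g \<in> borel_measurable borel" unfolding g_def[abs_def] by measurable
  have fm[measurable]: "f \<in> borel_measurable (borel \<Otimes>\<^sub>M N)" unfolding f_def by measurable
  have \<kappa>: "\<kappa> \<in> borel \<rightarrow>\<^sub>M subprob_algebra N" and \<kappa>p: "\<kappa> \<in> borel \<rightarrow>\<^sub>M prob_algebra N"
    using cond by (auto simp: regular_cond_distr_def measurable_prob_algebraD)
  have \<kappa>z: "prob_space (\<kappa> z)" for z
    using measurable_space[OF \<kappa>p, of z] by (simp add: space_prob_algebra)
  have \<kappa>s[measurable_cong]: "sets (\<kappa> z) = sets N" for z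
    using sets_kernel[OF \<kappa>, of z] by simp
  interpret R: prob_space ?\<rho> by (rule prob_space_distr[OF XY])
  let ?v = "\<lambda>p. of_bool (K (dist x (fst p) / h) > 0) * ennreal ((norm (L (G (snd p) - g (fst p))))\<^sup>2)"
  have vm: "?v \<in> borel_measurable (borel \<Otimes>\<^sub>M N)" by measurable
  have var: "(\<integral>\<^sup>+p. ?v p \<partial>?\<rho>) \<le> ennreal (l\<^sup>2 * b * ?p)"
  proof -
    have "(\<integral>\<^sup>+p. ?v p \<partial>?\<rho>) = (\<integral>\<^sup>+z. \<integral>\<^sup>+y. ?v (z, y) \<partial>\<kappa> z \<partial>distr M borel X)"
      by (rule nn_integral_regular_cond_distr[OF M XY cond vm])
    also have "\<dots> \<le> (\<integral>\<^sup>+z. ennreal (l\<^sup>2 * b) * indicator {z. dist x z \<le> h} z \<partial>distr M borel X)"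
    proof (rule nn_integral_mono)
      fix z
      show "(\<integral>\<^sup>+y. ?v (z, y) \<partial>\<kappa> z) \<le> ennreal (l\<^sup>2 * b) * indicator {z. dist x z \<le> h} z"
      proof (cases "dist x z \<le> h")
        case True
        have "(\<integral>\<^sup>+y. ?v (z, y) \<partial>\<kappa> z) \<le> (\<integral>\<^sup>+y. ennreal (l\<^sup>2) * ennreal ((norm (G y - g z))\<^sup>2) \<partial>\<kappa> z)"
        proof (rule nn_integral_mono)
          fix y
          have "(norm (L (G y - g z)))\<^sup>2 \<le> (norm (G y - g z) * l)\<^sup>2"
            by (intro power_mono l) auto
          then have "ennreal ((norm (L (G y - g z)))\<^sup>2) \<le> ennreal (l\<^sup>2 * (norm (G y - g z))\<^sup>2)"
            by (intro ennreal_leI) (simp add: power_mult_distrib mult.commute)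
          then show "?v (z, y) \<le> ennreal (l\<^sup>2) * ennreal ((norm (G y - g z))\<^sup>2)"
            by (cases "K (dist x z / h) > 0") (auto simp: ennreal_mult)
        qed
        also have "\<dots> = ennreal (l\<^sup>2) * (\<integral>\<^sup>+y. ennreal ((norm (G y - g z))\<^sup>2) \<partial>\<kappa> z)"
          by (rule nn_integral_cmult) measurable
        also have "\<dots> \<le> ennreal (l\<^sup>2) * ennreal b"
          using G_local[OF True] by (intro mult_left_mono) (auto simp: g_def)
        finally show ?thesis using True b by (simp add: ennreal_mult)
      qed (simp add: kernel_pos_iff)
    qed
    also have "\<dots> = ennreal (l\<^sup>2 * b) * emeasure (distr M borel X) {z. dist x z \<le> h}"
      by (subst nn_integral_cmult) auto
    also have "emeasure (distr M borel X) {z. dist x z \<le> h} = ennreal ?p"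
      by (subst emeasure_distr)
        (auto simp: small_ball_prob_def emeasure_eq_measure intro!: arg_cong[where f=prob])
    also have "ennreal (l\<^sup>2 * b) * ennreal ?p = ennreal (l\<^sup>2 * b * ?p)"
      using b p by (simp add: ennreal_mult)
    finally show ?thesis .
  qed
  \<comment> \<open>Disintegrating the mean requires \<open>f\<close> to be integrable; this follows
    from the second moment through \<open>t \<le> 1 + t\<^sup>2\<close>.\<close>
  have int_f: "integrable ?\<rho> f"
  proof (rule integrableI_bounded)
    have "(\<integral>\<^sup>+p. ennreal (norm (f p)) \<partial>?\<rho>) \<le> (\<integral>\<^sup>+p. ennreal k_hi * (1 + ?v p) \<partial>?\<rho>)"
    proof (rule nn_integral_mono)
      fix p
      have q: "t \<le> 1 + t\<^sup>2" if "t \<ge> 0" for t :: real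
        using sum_squares_bound[of t 1] that by (simp add: power2_eq_square)
      have *: "norm (f p) \<le> k_hi * (1 + (norm (L (G (snd p) - g (fst p))))\<^sup>2)" if "dist x (fst p) \<le> h"
        using that kernel_cases[of "fst p"] K_const q[of "norm (L (G (snd p) - g (fst p)))"]
        unfolding f_def by (auto intro!: mult_mono)
      show "ennreal (norm (f p)) \<le> ennreal k_hi * (1 + ?v p)"
      proof (cases "dist x (fst p) \<le> h")
        case True
        have "ennreal (norm (f p)) \<le> ennreal (k_hi * (1 + (norm (L (G (snd p) - g (fst p))))\<^sup>2))"
          by (rule ennreal_leI[OF *[OF True]])
        also have "\<dots> = ennreal k_hi * (1 + ennreal ((norm (L (G (snd p) - g (fst p))))\<^sup>2))"
          using K_const by (subst ennreal_mult) auto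
        finally show ?thesis using True by (simp add: kernel_pos_iff)
      next
        case False
        then have "K (dist x (fst p) / h) = 0" using kernel_cases[of "fst p"] by auto
        then show ?thesis by (simp add: f_def)
      qed
    qed
    also have "\<dots> = ennreal k_hi * (1 + (\<integral>\<^sup>+p. ?v p \<partial>?\<rho>))"
      using vm by (simp add: nn_integral_cmult nn_integral_add R.emeasure_space_1[simplified])
    also have "\<dots> < \<infinity>"
      using le_less_trans[OF var ennreal_less_top] by (auto simp: ennreal_mult_less_top)
    finally show "(\<integral>\<^sup>+p. ennreal (norm (f p)) \<partial>?\<rho>) < \<infinity>" .
  qed simp
  have mean: "integral\<^sup>L ?\<rho> f = 0"
  proof -
    \<comment> \<open>Inside the ball \<open>G\<close> is integrable under
      \<open>\<kappa> z\<close>, so \<open>g z\<close> is a genuine mean and \<open>L\<close>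
      commutes with the integral; outside, the kernel vanishes.\<close>
    have inner: "(\<integral>y. f (z, y) \<partial>\<kappa> z) = 0" for z
    proof (cases "dist x z \<le> h")
      case True
      interpret Z: prob_space "\<kappa> z" by (rule \<kappa>z)
      have G: "integrable (\<kappa> z) G" using G_local[OF True] by simp
      then have "(\<integral>y. L (G y - g z) \<partial>\<kappa> z) = L (\<integral>y. G y - g z \<partial>\<kappa> z)"
        by (intro integral_bounded_linear L) auto
      moreover have "(\<integral>y. G y - g z \<partial>\<kappa> z) = 0"
        using G by (simp add: g_def Z.prob_space)
      ultimately show ?thesis by (simp add: f_def linear_0[OF bounded_linear.linear[OF L]])
    next
      case False
      then have "K (dist x z / h) = 0" using kernel_cases[of z] by auto
      then show ?thesis by (simp add: f_def)
    qed
    have "integral\<^sup>L ?\<rho> f = (\<integral>z. \<integral>y. f (z, y) \<partial>\<kappa> z \<partial>distr M borel X)"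
      by (rule integral_regular_cond_distr[OF M XY cond int_f])
    then show ?thesis by (simp add: inner)
  qed
  let ?e = "\<lambda>i \<omega>. L (G (Ys i \<omega>) - g (Xs i \<omega>))"
  have "(\<integral>\<^sup>+\<omega>. ennreal ((norm ((\<Sum>i=1..n. kernel_weight K x Xs h \<omega> i *\<^sub>R ?e i \<omega>)
      /\<^sub>R (\<Sum>i=1..n. kernel_weight K x Xs h \<omega> i)))\<^sup>2) \<partial>M) \<le>
    ennreal ((4 * c * k_hi\<^sup>2 * (l\<^sup>2 * b) / k_lo\<^sup>2 + 2 * k_hi * (l\<^sup>2 * b) / (k_lo * (1 - ln 2))) / (n * ?p))"
  proof (rule self_normalized_second_moment[OF type2 c K_const n p])
    have "(\<lambda>p. (K (dist x (fst p) / h), L (G (snd p) - g (fst p)))) \<in> borel \<Otimes>\<^sub>M N \<rightarrow>\<^sub>M borel"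
      unfolding borel_prod[symmetric] by measurable
    from indep_vars_compose2[OF indep_sample this]
    show "indep_vars (\<lambda>_. borel) (\<lambda>i \<omega>. (kernel_weight K x Xs h \<omega> i, ?e i \<omega>)) {1..n}"
      by (simp add: kernel_weight_def)
    show "kernel_weight K x Xs h \<omega> i = 0 \<or> k_lo \<le> kernel_weight K x Xs h \<omega> i \<and> kernel_weight K x Xs h \<omega> i \<le> k_hi"
      for i \<omega> using kernel_cases[of "Xs i \<omega>"] by (auto simp: kernel_weight_def)
    show "0 \<le> l\<^sup>2 * b" using b by simp
  next
    fix i assume "i \<in> {1..n}"
    then have i: "i \<ge> 1" by simp
    show "prob {\<omega>\<in>space M. 0 < kernel_weight K x Xs h \<omega> i} = ?p" by (rule prob_weight_pos[OF i])
    have "expectation (\<lambda>\<omega>. f (Xs i \<omega>, Ys i \<omega>)) = integral\<^sup>L ?\<rho> f"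
      unfolding ident[OF i, symmetric] by (rule integral_distr[OF sample_measurable[OF i] fm, symmetric])
    then show "expectation (\<lambda>\<omega>. kernel_weight K x Xs h \<omega> i *\<^sub>R ?e i \<omega>) = 0"
      using mean by (simp add: f_def kernel_weight_def)
    have "(\<integral>\<^sup>+\<omega>. ?v (Xs i \<omega>, Ys i \<omega>) \<partial>M) = (\<integral>\<^sup>+p. ?v p \<partial>?\<rho>)"
      unfolding ident[OF i, symmetric] by (subst nn_integral_distr[OF sample_measurable[OF i]]) (use vm in simp_all)
    then show "(\<integral>\<^sup>+\<omega>. of_bool (0 < kernel_weight K x Xs h \<omega> i) * ennreal ((norm (?e i \<omega>))\<^sup>2) \<partial>M) \<le> ennreal (l\<^sup>2 * b * ?p)"
      using var by (simp add: kernel_weight_def)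
  qed
  then show ?thesis unfolding variance_term_eq g_def .
qed

end

section \<open>Choice of the bandwidth and the resulting rates\<close>

theorem theorem5:
  fixes M :: "'w measure" and N :: "'r measure"
    and X :: "'w \<Rightarrow> 'c::polish_space" and Y :: "'w \<Rightarrow> 'r"
    and Xs :: "nat \<Rightarrow> 'w \<Rightarrow> 'c" and Ys :: "nat \<Rightarrow> 'w \<Rightarrow> 'r"
    and \<kappa> :: "'c \<Rightarrow> 'r measure" and x :: 'c
    and K :: "real \<Rightarrow> real"
    and F :: "'c \<Rightarrow> 'g::{banach, second_countable_topology}" and G :: "'r \<Rightarrow> 'g"
    and L :: "'g \<Rightarrow> 'b::{banach, second_countable_topology}"
    and T :: "'r measure \<Rightarrow> 'b"
    and C1 C2 C3 C4 t1 t2 t3 t4 k_lo k_hi \<beta> b_F \<nu> :: real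
  defines "m \<equiv> small_ball_exponent C2 t2 t3"
  defines "m_inv \<equiv> the_inv_into {0<..<1} m"
  assumes "prob_space M"
    and XY: "(\<lambda>\<omega>. (X \<omega>, Y \<omega>)) \<in> M \<rightarrow>\<^sub>M borel \<Otimes>\<^sub>M N"
    and indep: "prob_space.indep_vars M (\<lambda>_. borel \<Otimes>\<^sub>M N) (\<lambda>i \<omega>. (Xs i \<omega>, Ys i \<omega>)) {1..}"
    and ident: "\<And>i. i \<ge> 1 \<Longrightarrow> distr M (borel \<Otimes>\<^sub>M N) (\<lambda>\<omega>. (Xs i \<omega>, Ys i \<omega>))
                  = distr M (borel \<Otimes>\<^sub>M N) (\<lambda>\<omega>. (X \<omega>, Y \<omega>))"
    and cond: "regular_cond_distr M borel X N Y \<kappa>"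
    and type2: "type_two TYPE('b)"
    and basis: "\<exists>I (e :: nat \<Rightarrow> 'b). schauder_basis I e"
    and F_meas: "F \<in> borel_measurable borel" and G_meas: "G \<in> borel_measurable N"
    and L: "bounded_linear L"
    and K_meas: "K \<in> borel_measurable (restrict_space borel {0..})"
    and K_nonneg: "\<And>u. u \<ge> 0 \<Longrightarrow> K u \<ge> 0"
    and estimate_meas: "\<And>h n. h > 0 \<Longrightarrow>
          (\<lambda>\<omega>. T (weighted_empirical N K x Xs Ys h n \<omega>)) \<in> borel_measurable M"
    and C_pos: "C1 > 0" "C2 > 0" "C3 > 0" "C4 > 0"
    and t_nonneg: "t1 \<ge> 0" "t2 \<ge> 0" "t3 \<ge> 0" "t4 \<ge> 0"
    and small_ball: "\<forall>\<^sub>F h in at_right 0.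
          C1 * h powr t1 * exp (- small_ball_exponent C2 t2 t3 h) \<le> small_ball_prob M X x h \<and>
          small_ball_prob M X x h \<le> C3 * h powr t4 * exp (- small_ball_exponent C4 t2 t3 h)"
    and exponents: "t2 > 0 \<or> (t3 > 1 \<and> t3 \<in> \<int> \<and> C2 = C4)"
    and K_const: "0 < k_lo" "k_lo \<le> k_hi"
    and K_on: "\<And>u. 0 \<le> u \<Longrightarrow> u \<le> 1 \<Longrightarrow> k_lo \<le> K u \<and> K u \<le> k_hi"
    and K_off: "\<And>u. u > 1 \<Longrightarrow> K u = 0"
    and \<beta>: "\<beta> > 0" and b_F: "b_F > 0"
    and F_local: "\<forall>\<^sub>F z in nhds x. norm (F z - F x) \<le> b_F * dist x z powr \<beta>"
    and \<nu>: "\<nu> > 2"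
    and G_local: "\<exists>b::real. \<forall>\<^sub>F z in nhds x. integrable (\<kappa> z) G \<and>
          (\<integral>\<^sup>+y. ennreal (norm (G y - (\<integral>y'. G y' \<partial>\<kappa> z)) powr \<nu>) \<partial>\<kappa> z) \<le> ennreal b"
    and remainder: "\<And>h. admissible_bandwidth M X x h \<Longrightarrow>
          smallo_in_prob M (\<lambda>n. remainder_term T L F G N \<kappa> K x Xs Ys (h n) n) (error_rate M X x \<beta> h)"
  shows "\<exists>h. admissible_bandwidth M X x h \<and>
    bigO_in_prob M (\<lambda>n. estimation_error T N \<kappa> K x Xs Ys (h n) n)
      (\<lambda>n. m_inv (ln (real n)) powr \<beta>) \<and>
    (mean_square_smallo M (\<lambda>n. remainder_term T L F G N \<kappa> K x Xs Ys (h n) n)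
        (\<lambda>n. (error_rate M X x \<beta> h n)\<^sup>2) \<longrightarrow>
     mean_square_bigO M (\<lambda>n. estimation_error T N \<kappa> K x Xs Ys (h n) n)
        (\<lambda>n. m_inv (ln (real n)) powr (2 * \<beta>)))"
proof -
  interpret prob_space M by fact
  note model = \<open>prob_space M\<close> XY indep ident cond F_meas G_meas L K_meas K_const K_on K_off
  let ?p = "small_ball_prob M X x"
  \<comment> \<open>An integer above 1 is at least 2, the form in which integrality enters
    \<open>small_ball_exponent_gap\<close>.\<close>
  have t23: "t2 > 0 \<or> t3 > 1" "t2 > 0 \<or> t3 \<ge> 2"
  proof -
    show "t2 > 0 \<or> t3 > 1" using exponents by auto
    show "t2 > 0 \<or> t3 \<ge> 2"
    proof (cases "t2 > 0")
      case False
      then obtain k :: int where "t3 = of_int k" "t3 > 1" using exponents by (auto elim: Ints_cases)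
      then show ?thesis by simp
    qed simp
  qed
  note m = C_pos(2) t_nonneg(2,3) t23(1)

  obtain \<delta> b where \<delta>: "\<delta> > 0" and F_ball: "\<And>z. dist x z < \<delta> \<Longrightarrow> norm (F z - F x) \<le> b_F * dist x z powr \<beta>"
    and G_ball: "\<And>z. dist x z < \<delta> \<Longrightarrow> integrable (\<kappa> z) G \<and>
      (\<integral>\<^sup>+y. ennreal (norm (G y - (\<integral>y'. G y' \<partial>\<kappa> z)) powr \<nu>) \<partial>\<kappa> z) \<le> ennreal b"
  proof -
    from G_local obtain b where b: "\<forall>\<^sub>F z in nhds x. integrable (\<kappa> z) G \<and>
      (\<integral>\<^sup>+y. ennreal (norm (G y - (\<integral>y'. G y' \<partial>\<kappa> z)) powr \<nu>) \<partial>\<kappa> z) \<le> ennreal b" by blast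
    from eventually_conj[OF F_local b] show thesis
      unfolding eventually_nhds_metric using that[of _ b] by (metis dist_commute)
  qed
  \<comment> \<open>The second moment is reduced to the moment of order \<open>\<nu>\<close> by
    \<open>t\<^sup>2 \<le> 1 + t powr \<nu>\<close>; the maximum covers a negative \<open>b\<close>,
    which \<open>ennreal\<close> sends to 0.\<close>
  define b2 where "b2 = 1 + max b 0"
  have b2: "b2 \<ge> 0" by (simp add: b2_def)
  have G_ball2: "integrable (\<kappa> z) G \<and>
      (\<integral>\<^sup>+y. ennreal ((norm (G y - (\<integral>y'. G y' \<partial>\<kappa> z)))\<^sup>2) \<partial>\<kappa> z) \<le> ennreal b2" if z: "dist x z < \<delta>" for z
  proof
    have \<kappa>: "\<kappa> \<in> borel \<rightarrow>\<^sub>M prob_algebra N" using cond by (simp add: regular_cond_distr_def)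
    interpret Z: prob_space "\<kappa> z" using measurable_space[OF \<kappa>, of z] by (simp add: space_prob_algebra)
    show G: "integrable (\<kappa> z) G" using G_ball[OF z] by simp
    let ?e = "\<lambda>y. norm (G y - (\<integral>y'. G y' \<partial>\<kappa> z))"
    have [measurable]: "G \<in> borel_measurable (\<kappa> z)" using G by auto
    have "(?e y)\<^sup>2 \<le> 1 + ?e y powr \<nu>" for y
    proof (cases "?e y \<le> 1")
      case True
      then have "(?e y)\<^sup>2 \<le> 1" by (simp add: power_le_one)
      then show ?thesis by (simp add: add_increasing2)
    next
      case False
      then have "?e y powr 2 \<le> ?e y powr \<nu>" using \<nu> by (intro powr_mono) auto
      then show ?thesis using False by (simp add: powr_numeral)
    qed
    then have "(\<integral>\<^sup>+y. ennreal ((?e y)\<^sup>2) \<partial>\<kappa> z) \<le> (\<integral>\<^sup>+y. 1 + ennreal (?e y powr \<nu>) \<partial>\<kappa> z)"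
      by (intro nn_integral_mono) (auto simp flip: ennreal_1 ennreal_plus intro!: ennreal_leI)
    also have "\<dots> = 1 + (\<integral>\<^sup>+y. ennreal (?e y powr \<nu>) \<partial>\<kappa> z)"
      by (simp add: nn_integral_add Z.emeasure_space_1)
    also have "\<dots> \<le> 1 + ennreal (max b 0)"
      using G_ball[OF z] by (intro add_left_mono order_trans[OF conjunct2[OF G_ball[OF z]]] ennreal_leI) auto
    also have "\<dots> = ennreal b2" by (simp add: b2_def)
    finally show "(\<integral>\<^sup>+y. ennreal ((?e y)\<^sup>2) \<partial>\<kappa> z) \<le> ennreal b2" .
  qed
  obtain l where l: "l > 0" "\<And>v. norm (L v) \<le> norm v * l"
    using bounded_linear.pos_bounded[OF L] by blast
  obtain c where c: "c > 0" and type2_c: "\<And>(W :: nat \<Rightarrow> 'w \<Rightarrow> 'b) n. indep_vars (\<lambda>_. borel) W {1..n} \<Longrightarrow>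
      (\<And>i. i \<in> {1..n} \<Longrightarrow> integrable M (W i) \<and> integral\<^sup>L M (W i) = 0 \<and>
        integrable M (\<lambda>\<omega>. (norm (W i \<omega>))\<^sup>2)) \<Longrightarrow>
      (\<integral>\<omega>. (norm (\<Sum>i=1..n. W i \<omega>))\<^sup>2 \<partial>M) \<le> c * (\<Sum>i=1..n. \<integral>\<omega>. (norm (W i \<omega>))\<^sup>2 \<partial>M)"
    using type_two_indep_vars[OF type2, where 'w='w] \<open>prob_space M\<close> by metis

  let ?B = "\<lambda>h n. bias_term L F K x Xs h n" and ?V = "\<lambda>h n. variance_term L G \<kappa> K x Xs Ys h n"
  \<comment> \<open>The factors 2 come from the square of a sum of two terms. \<open>A2\<close>
    joins the empty-ball part of the bias with the variance constant, both being divided by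
    \<open>n * ?p h\<close>.\<close>
  define A1 where "A1 = 2 * (b_F * l)\<^sup>2"
  define A2 where "A2 = 2 * ((norm (L (F x)))\<^sup>2 * (2 / (1 - ln 2)) +
    (4 * c * k_hi\<^sup>2 * (l\<^sup>2 * b2) / k_lo\<^sup>2 + 2 * k_hi * (l\<^sup>2 * b2) / (k_lo * (1 - ln 2))))"
  have A: "A1 \<ge> 0" "A2 \<ge> 0"
    using c K_const b2 ln_2_less_1 by (auto simp: A1_def A2_def intro!: add_nonneg_nonneg mult_nonneg_nonneg divide_nonneg_nonneg)
  have BV: "(\<integral>\<^sup>+\<omega>. ennreal ((norm (?B h n \<omega> + ?V h n \<omega>))\<^sup>2) \<partial>M) \<le>
      ennreal (A1 * (h powr \<beta>)\<^sup>2 + A2 / (n * ?p h))"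
    if h: "0 < h" "h < \<delta>" and n: "n \<ge> 1" and p: "?p h > 0" for h n
  proof -
    note meas[measurable] = bias_term_measurable[OF model h(1)] variance_term_measurable[OF model h(1)]
    have B: "(\<integral>\<^sup>+\<omega>. ennreal ((norm (?B h n \<omega>))\<^sup>2) \<partial>M) \<le>
      ennreal ((b_F * h powr \<beta> * l)\<^sup>2 + (norm (L (F x)))\<^sup>2 * (2 / ((1 - ln 2) * (n * ?p h))))"
    proof (rule bias_second_moment[OF model h(1) n p _ l(2)])
      fix z assume z: "dist x z \<le> h"
      then have "norm (F z - F x) \<le> b_F * dist x z powr \<beta>" using F_ball h by auto
      also have "\<dots> \<le> b_F * h powr \<beta>"
        using z b_F \<beta> by (intro mult_left_mono powr_mono2) auto
      finally show "norm (F z - F x) \<le> b_F * h powr \<beta>" .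
    qed
    have V: "(\<integral>\<^sup>+\<omega>. ennreal ((norm (?V h n \<omega>))\<^sup>2) \<partial>M) \<le>
      ennreal ((4 * c * k_hi\<^sup>2 * (l\<^sup>2 * b2) / k_lo\<^sup>2 + 2 * k_hi * (l\<^sup>2 * b2) / (k_lo * (1 - ln 2))) / (n * ?p h))"
      by (rule variance_second_moment[OF model h(1) n p b2 _ l(2) type2_c c]) (use G_ball2 h in auto)
    have sq: "(norm (u + v))\<^sup>2 \<le> 2 * (norm u)\<^sup>2 + 2 * (norm v)\<^sup>2" for u v :: 'b
      using norm_sum_power2_le[of "case_bool u v" UNIV] by (simp add: UNIV_bool algebra_simps)
    have "(\<integral>\<^sup>+\<omega>. ennreal ((norm (?B h n \<omega> + ?V h n \<omega>))\<^sup>2) \<partial>M) \<le>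
      (\<integral>\<^sup>+\<omega>. 2 * ennreal ((norm (?B h n \<omega>))\<^sup>2) + 2 * ennreal ((norm (?V h n \<omega>))\<^sup>2) \<partial>M)"
    proof (rule nn_integral_mono)
      fix \<omega>
      have "ennreal ((norm (?B h n \<omega> + ?V h n \<omega>))\<^sup>2) \<le> ennreal (2 * (norm (?B h n \<omega>))\<^sup>2 + 2 * (norm (?V h n \<omega>))\<^sup>2)"
        by (rule ennreal_leI[OF sq])
      then show "ennreal ((norm (?B h n \<omega> + ?V h n \<omega>))\<^sup>2) \<le> 2 * ennreal ((norm (?B h n \<omega>))\<^sup>2) + 2 * ennreal ((norm (?V h n \<omega>))\<^sup>2)"
        by (simp add: ennreal_mult)
    qed
    also have "\<dots> = 2 * (\<integral>\<^sup>+\<omega>. ennreal ((norm (?B h n \<omega>))\<^sup>2) \<partial>M) + 2 * (\<integral>\<^sup>+\<omega>. ennreal ((norm (?V h n \<omega>))\<^sup>2) \<partial>M)"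
      by (simp add: nn_integral_add nn_integral_cmult)
    also have "\<dots> \<le> ennreal 2 * ennreal ((b_F * h powr \<beta> * l)\<^sup>2 + (norm (L (F x)))\<^sup>2 * (2 / ((1 - ln 2) * (n * ?p h)))) +
      ennreal 2 * ennreal ((4 * c * k_hi\<^sup>2 * (l\<^sup>2 * b2) / k_lo\<^sup>2 + 2 * k_hi * (l\<^sup>2 * b2) / (k_lo * (1 - ln 2))) / (n * ?p h))"
      using B V by (intro add_mono mult_mono) auto
    also have "\<dots> = ennreal (2 * ((b_F * h powr \<beta> * l)\<^sup>2 + (norm (L (F x)))\<^sup>2 * (2 / ((1 - ln 2) * (n * ?p h)))) +
      2 * ((4 * c * k_hi\<^sup>2 * (l\<^sup>2 * b2) / k_lo\<^sup>2 + 2 * k_hi * (l\<^sup>2 * b2) / (k_lo * (1 - ln 2))) / (n * ?p h)))"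
    proof -
      have "0 \<le> (4 * c * k_hi\<^sup>2 * (l\<^sup>2 * b2) / k_lo\<^sup>2 + 2 * k_hi * (l\<^sup>2 * b2) / (k_lo * (1 - ln 2))) / (n * ?p h)"
        using c K_const b2 ln_2_less_1 p by (intro add_nonneg_nonneg mult_nonneg_nonneg divide_nonneg_nonneg) auto
      moreover have "0 \<le> (b_F * h powr \<beta> * l)\<^sup>2 + (norm (L (F x)))\<^sup>2 * (2 / ((1 - ln 2) * (n * ?p h)))"
        using ln_2_less_1 p by (intro add_nonneg_nonneg mult_nonneg_nonneg divide_nonneg_nonneg) auto
      ultimately show ?thesis
        by (simp only: ennreal_mult[symmetric] ennreal_plus[symmetric] mult_nonneg_nonneg zero_le_numeral)
    qed
    also have "2 * ((b_F * h powr \<beta> * l)\<^sup>2 + (norm (L (F x)))\<^sup>2 * (2 / ((1 - ln 2) * (n * ?p h)))) +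
      2 * ((4 * c * k_hi\<^sup>2 * (l\<^sup>2 * b2) / k_lo\<^sup>2 + 2 * k_hi * (l\<^sup>2 * b2) / (k_lo * (1 - ln 2))) / (n * ?p h)) =
      A1 * (h powr \<beta>)\<^sup>2 + A2 / (n * ?p h)"
      by (simp add: A1_def A2_def power_mult_distrib add_divide_distrib distrib_left mult_ac)
    finally show ?thesis .
  qed

  obtain u0 where inv: "\<And>u. u > u0 \<Longrightarrow> m_inv u \<in> {0<..<1}" "\<And>u. u > u0 \<Longrightarrow> m (m_inv u) = u"
    and inv_lim: "filterlim m_inv (at_right 0) at_top"
    using small_ball_exponent_inverse[OF m] unfolding m_inv_def m_def by blast
  \<comment> \<open>\<open>t1\<close> cancels the factor \<open>h powr t1\<close> of the lower small
    ball bound, and \<open>2 * \<beta>\<close> brings \<open>1 / (n p)\<close> down to the squared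
    rate. The further 1 is a margin, given up again in \<open>inv_np\<close>.\<close>
  define q where "q = t1 + 2 * \<beta> + 1"
  have q: "q \<ge> 0" using \<beta> t_nonneg by (simp add: q_def)
  obtain a where a: "a > 1" and gap: "\<forall>\<^sub>F g in at_right 0. m (a * g) + q * ln (1 / g) \<le> m g"
    using small_ball_exponent_gap[OF m t23(2) q] unfolding m_def by blast

  define r where "r n = m_inv (ln (real n))" for n :: nat
  \<comment> \<open>For small \<open>n\<close> the value of \<open>m_inv\<close> is unspecified; the
    default 1 keeps every bandwidth positive, as admissibility demands.\<close>
  define h where "h n = (if r n > 0 then a * r n else 1)" for n
  have ln_lim: "filterlim (\<lambda>n. ln (real n)) at_top sequentially"
    by (rule filterlim_compose[OF ln_at_top filterlim_real_sequentially])
  have r_lim: "filterlim r (at_right 0) sequentially"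
    unfolding r_def by (rule filterlim_compose[OF inv_lim ln_lim])
  have r01: "\<forall>\<^sub>F n in sequentially. 0 < r n \<and> r n < 1 \<and> m (r n) = ln (real n)"
    using ln_lim[unfolded filterlim_at_top_dense, rule_format, of u0]
    by eventually_elim (use inv in \<open>auto simp: r_def\<close>)
  have h_pos: "h n > 0" for n using a by (simp add: h_def)
  have ar_lim: "filterlim (\<lambda>n. a * r n) (at_right 0) sequentially"
  proof -
    have "((\<lambda>g. a * g) \<longlongrightarrow> a * 0) (at_right 0)" by (intro tendsto_intros)
    then have "filterlim (\<lambda>g. a * g) (at_right 0) (at_right 0)"
      using a eventually_at_right_less[of "0::real"]
      by (auto simp: filterlim_at elim!: eventually_mono)
    from filterlim_compose[OF this r_lim] show ?thesis .
  qed
  have h_eq: "\<forall>\<^sub>F n in sequentially. h n = a * r n"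
    using r01 by eventually_elim (simp add: h_def)
  have h_lim: "filterlim h (at_right 0) sequentially"
    using ar_lim h_eq by (subst filterlim_cong[OF refl refl h_eq])
  \<comment> \<open>As \<open>m (r n) = ln (real n)\<close>, the factor \<open>n\<close> cancels
    against \<open>exp (- m (r n))\<close>. What remains of \<open>exp (- m (a * r n))\<close> is at
    least \<open>r n powr (- q)\<close>, of which \<open>h n powr t1\<close> absorbs the part
    \<open>t1\<close>, since \<open>a powr t1 \<ge> 1\<close>.\<close>
  have np: "\<forall>\<^sub>F n in sequentially. real n * ?p (h n) \<ge> C1 * r n powr (- (2 * \<beta> + 1)) \<and> n \<ge> 1"
    using r01 h_eq eventually_ge_at_top[of 1]
      eventually_compose_filterlim[OF gap r_lim] eventually_compose_filterlim[OF small_ball h_lim]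
  proof eventually_elim
    case (elim n)
    have r: "0 < r n" "r n < 1" "m (r n) = ln (real n)" using elim by auto
    have "C1 * r n powr (- (2 * \<beta> + 1)) = C1 * 1 * (r n powr t1 * r n powr (- q))"
      using r by (simp add: q_def flip: powr_add)
    also have "\<dots> \<le> C1 * a powr t1 * (r n powr t1 * r n powr (- q))"
      using C_pos a t_nonneg by (intro mult_right_mono mult_left_mono ge_one_powr_ge_zero) auto
    also have "\<dots> = C1 * h n powr t1 * r n powr (- q)"
      using r a elim by (simp add: powr_mult mult_ac)
    also have "r n powr (- q) = real n * exp (- ln (real n) + q * ln (1 / r n))"
    proof -
      have "real n * exp (- ln (real n) + y) = exp y" for y
        using elim(3) by (simp add: exp_diff)
      moreover have "r n powr (- q) = exp (q * ln (1 / r n))"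
        using r by (simp add: powr_def ln_div)
      ultimately show ?thesis by simp
    qed
    also have "C1 * h n powr t1 * (real n * exp (- ln (real n) + q * ln (1 / r n))) \<le>
        C1 * h n powr t1 * (real n * exp (- m (h n)))"
      using elim r C_pos by (intro mult_left_mono) auto
    also have "\<dots> = real n * (C1 * h n powr t1 * exp (- m (h n)))" by simp
    also have "\<dots> \<le> real n * ?p (h n)"
      using elim by (intro mult_left_mono) (auto simp: m_def)
    finally show ?case using elim by simp
  qed
  have np_lim: "filterlim (\<lambda>n. real n * ?p (h n)) at_top sequentially"
  proof (rule filterlim_at_top_mono)
    have "filterlim (\<lambda>g::real. C1 * g powr (- (2 * \<beta> + 1))) at_top (at_right 0)"
      using C_pos \<beta> by real_asymp
    from filterlim_compose[OF this r_lim]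
    show "filterlim (\<lambda>n. C1 * r n powr (- (2 * \<beta> + 1))) at_top sequentially" .
    show "\<forall>\<^sub>F n in sequentially. C1 * r n powr (- (2 * \<beta> + 1)) \<le> real n * ?p (h n)"
      using np by eventually_elim simp
  qed
  have adm: "admissible_bandwidth M X x h"
    using h_pos h_lim np_lim by (simp add: admissible_bandwidth_def filterlim_at)
  have inv_np: "\<forall>\<^sub>F n in sequentially. real n * ?p (h n) \<ge> C1 * r n powr (- (2 * \<beta>))"
    using np r01
  proof eventually_elim
    case (elim n)
    then have "r n powr (- (2 * \<beta>)) \<le> r n powr (- (2 * \<beta> + 1))"
      by (intro powr_mono') auto
    then have "C1 * r n powr (- (2 * \<beta>)) \<le> C1 * r n powr (- (2 * \<beta> + 1))"
      using C_pos by (intro mult_left_mono) auto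
    then show ?case using elim by linarith
  qed

  let ?Z = "\<lambda>n \<omega>. ?B (h n) n \<omega> + ?V (h n) n \<omega>"
  let ?R = "\<lambda>n. remainder_term T L F G N \<kappa> K x Xs Ys (h n) n"
  let ?err = "\<lambda>n. estimation_error T N \<kappa> K x Xs Ys (h n) n"
  let ?d = "error_rate M X x \<beta> h"
  \<comment> \<open>In \<open>dr\<close> the maximum of the two parts of the error rate is bounded
    by their sum: \<open>a powr \<beta>\<close> stems from the bandwidth,
    \<open>C1 powr (- 1 / 2)\<close> from the lower bound on \<open>n p\<close>. \<open>A0\<close>
    arises in the same way from \<open>A1\<close> and \<open>A2\<close>.\<close>
  define E where "E = a powr \<beta> + C1 powr (- 1 / 2)"
  define A0 where "A0 = A1 * (a powr \<beta>)\<^sup>2 + A2 / C1"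
  have Zm: "?Z n \<in> borel_measurable M" for n
    using bias_term_measurable[OF model h_pos] variance_term_measurable[OF model h_pos]
    by (intro borel_measurable_add)
  have errm: "?err n \<in> borel_measurable M" for n
    unfolding estimation_error_def[abs_def] by (intro borel_measurable_diff estimate_meas h_pos) auto
  \<comment> \<open>An identity at every sample point, because the remainder is defined as the
    difference.\<close>
  have err: "?err n = (\<lambda>\<omega>. ?Z n \<omega> + ?R n \<omega>)" for n
    by (simp add: remainder_term_def fun_eq_iff)
  have Rm: "?R n \<in> borel_measurable M" for n
    unfolding remainder_term_def[abs_def]
    using errm bias_term_measurable[OF model h_pos] variance_term_measurable[OF model h_pos]
    by (intro borel_measurable_diff)
  have dr: "\<forall>\<^sub>F n in sequentially. ?d n \<le> E * r n powr \<beta>"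
    using r01 h_eq inv_np
  proof eventually_elim
    case (elim n)
    have "h n powr \<beta> = a powr \<beta> * r n powr \<beta>" using elim a by (simp add: powr_mult)
    moreover have "(real n * ?p (h n)) powr (- 1 / 2) \<le> (C1 * r n powr (- (2 * \<beta>))) powr (- 1 / 2)"
      using elim C_pos by (intro powr_mono2') auto
    moreover have "(C1 * r n powr (- (2 * \<beta>))) powr (- 1 / 2) = C1 powr (- 1 / 2) * r n powr \<beta>"
      using elim C_pos by (simp add: powr_mult powr_powr)
    ultimately show ?case by (simp add: error_rate_def E_def distrib_right add_increasing)
  qed
  have Z2: "\<forall>\<^sub>F n in sequentially. (\<integral>\<^sup>+\<omega>. ennreal ((norm (?Z n \<omega>))\<^sup>2) \<partial>M) \<le> ennreal (A0 * (r n powr \<beta>)\<^sup>2)"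
  proof -
    have "\<forall>\<^sub>F n in sequentially. h n < \<delta>"
      using h_lim \<delta> by (auto simp: filterlim_at dest: order_tendstoD(2))
    with r01 h_eq inv_np np show ?thesis
    proof eventually_elim
      case (elim n)
      have r: "r n > 0" using elim by simp
      have pos: "0 < C1 * r n powr (- (2 * \<beta>))" using C_pos r by simp
      then have np0: "real n * ?p (h n) > 0" using elim by linarith
      then have p: "?p (h n) > 0" by (simp add: zero_less_mult_iff)
      have "(\<integral>\<^sup>+\<omega>. ennreal ((norm (?Z n \<omega>))\<^sup>2) \<partial>M) \<le> ennreal (A1 * (h n powr \<beta>)\<^sup>2 + A2 / (n * ?p (h n)))"
        using elim by (intro BV h_pos p) auto
      also have "\<dots> \<le> ennreal (A0 * (r n powr \<beta>)\<^sup>2)"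
      proof (rule ennreal_leI)
        have "A2 / (n * ?p (h n)) \<le> A2 / (C1 * r n powr (- (2 * \<beta>)))"
          using elim(3) A(2) mult_pos_pos[OF np0 pos] by (intro divide_left_mono) auto
        also have "\<dots> = A2 / C1 * (r n powr \<beta>)\<^sup>2"
          using r by (simp add: powr_minus powr_power field_simps)
        finally show "A1 * (h n powr \<beta>)\<^sup>2 + A2 / (n * ?p (h n)) \<le> A0 * (r n powr \<beta>)\<^sup>2"
          using elim a by (simp add: A0_def powr_mult power_mult_distrib algebra_simps)
      qed
      finally show ?case .
    qed
  qed
  have A0: "A0 \<ge> 0" using A C_pos by (simp add: A0_def)
  have E: "E > 0" using a by (auto simp: E_def intro: add_pos_nonneg)
  have d0: "?d n \<ge> 0" for n by (simp add: error_rate_def max.coboundedI1)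
  have r_pos: "\<forall>\<^sub>F n in sequentially. r n powr \<beta> > 0"
    using r01 by eventually_elim simp
  note rates = Zm Rm A0 E d0 r_pos dr Z2
  have 1: "bigO_in_prob M ?err (\<lambda>n. r n powr \<beta>)"
    unfolding err by (rule bigO_in_prob_sum[OF rates remainder[OF adm]])
  have 2: "mean_square_bigO M ?err (\<lambda>n. (r n powr \<beta>)\<^sup>2)" if "mean_square_smallo M ?R (\<lambda>n. (?d n)\<^sup>2)"
    unfolding err by (rule mean_square_bigO_sum[OF rates that])
  \<comment> \<open>Valid for every real \<open>r n\<close>, also for the unspecified early values:
    away from 0, \<open>powr\<close> is an exponential by definition, and at 0 both sides
    vanish.\<close>
  have sq: "(r n powr \<beta>)\<^sup>2 = r n powr (2 * \<beta>)" for n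
    by (cases "r n = 0") (simp_all add: powr_def power2_eq_square flip: exp_add)
  show ?thesis
    using adm 1 2 unfolding sq unfolding r_def by blast
qed

end
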